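(* Let $q\colon\mathbb{C}\setminus\mathbb{R}\to\mathbb{C}$ be a holomorphic function. Then $q$ is a quasi-Herglotz function if and only if there exist a number $c\in\mathbb{C}$ and a complex Borel measure $\sigma$ on the unit circle $S^1$ such that, for every $z\in\mathbb{C}\setminus\mathbb{R}$, $$q(z)=c+(\mathfrak{C}\sigma)(\varphi(z)).$$ Furthermore, the number $c$ is given in terms of the function $q$ (or its data $(a,b,\nu)$) as $$c=q(-\mathrm{i})=a-\mathrm{i}\left(b+\frac{1}{\pi}\int_{\mathbb{R}}\mathrm{d}\nu(t)\right).$$
   Context: A Herglotz function is a holomorphic function $h\colon\mathbb{C}\setminus\mathbb{R}\to\mathbb{C}$ with $\frac{\operatorname{Im}[h(z)]}{\operatorname{Im}[z]}\ge 0$ and $\overline{h(z)}=h(\overline{z})$ for all $z\in\mathbb{C}\setminus\mathbb{R}$. A function $q\colon\mathbb{C}\setminus\mathbb{R}\to\mathbb{C}$ is a quasi-Herglotz function if there exist Herglotz functions $h_1,h_2,h_3,h_4$ such that $q(z)=(h_1-h_2)(z)+\mathrm{i}\,(h_3-h_4)(z)$ for all $z\in\mathbb{C}\setminus\mathbb{R}$. Every quasi-Herglotz function $q$ has a unique representation $q(z)=a+b\,z+\frac{1}{\pi}\int_{\mathbb{R}}\frac{1+t\,z}{t-z}\,\mathrm{d}\nu(t)$, $z\in\mathbb{C}\setminus\mathbb{R}$, with $a,b\in\mathbb{C}$ and $\nu$ a complex (hence finite) Borel measure on $\mathbb{R}$; the triple $(a,b,\nu)$ is called the data of $q$. Let $\hat{\mathbb{C}}=\mathbb{C}\cup\{\infty\}$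 be the Riemann sphere. The Cauchy transform of a complex Borel measure $\sigma$ on $S^1=\{\zeta\in\mathbb{C}:|\zeta|=1\}$ is the function $\mathfrak{C}\sigma$ on $\hat{\mathbb{C}}\setminus S^1$ given by $$(\mathfrak{C}\sigma)(\tau):=\int_{S^1}\frac{1}{1-\overline{\zeta}\,\tau}\,\mathrm{d}\sigma(\zeta)=\int_{S^1}\frac{\zeta}{\zeta-\tau}\,\mathrm{d}\sigma(\zeta),\qquad (\mathfrak{C}\sigma)(\infty)=0.$$ The inverse Cayley transform is $\varphi(z)=\frac{z-\mathrm{i}}{z+\mathrm{i}}$, viewed as an automorphism of $\hat{\mathbb{C}}$ (so $\varphi(-\mathrm{i})=\infty$); it maps $\mathbb{C}\setminus\mathbb{R}$ into $\hat{\mathbb{C}}\setminus S^1$. *)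

theory Defs
  imports "HOL-Complex_Analysis.Complex_Analysis"
begin

section \<open>Complex measures and integration against them\<close>

text \<open>Only the measurable space underlying \<open>M\<close> matters here, not its measure; the values of
  \<open>\<nu>\<close> on non-measurable sets are irrelevant.\<close>

definition complex_measure :: "'a measure \<Rightarrow> ('a set \<Rightarrow> complex) \<Rightarrow> bool" where
  "complex_measure M \<nu> \<longleftrightarrow>
     \<nu> {} = 0 \<and>
     (\<forall>A :: nat \<Rightarrow> 'a set. range A \<subseteq> sets M \<longrightarrow> disjoint_family A \<longrightarrow>
        (\<lambda>i. \<nu> (A i)) sums \<nu> (\<Union>i. A i))"

text \<open>The Jordan decomposition of a finite signed measure is \<open>\<mu> = \<mu>\<^sup>+ - \<mu>\<^sup>-\<close>, where the upper variation
  is \<open>\<mu>\<^sup>+(A) = sup {\<mu>(B) | B \<subseteq> A measurable}\<close> and the lower variation \<open>\<mu>\<^sup>-\<close> is the upper variation of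
  \<open>-\<mu>\<close>. Since \<open>ennreal\<close> sends negative reals to \<open>0 = \<mu> {}\<close>, it does not affect the supremum.\<close>

definition upper_variation :: "'a measure \<Rightarrow> ('a set \<Rightarrow> real) \<Rightarrow> 'a measure" where
  "upper_variation M \<mu> =
     measure_of (space M) (sets M) (\<lambda>A. SUP B\<in>{B \<in> sets M. B \<subseteq> A}. ennreal (\<mu> B))"

definition lower_variation :: "'a measure \<Rightarrow> ('a set \<Rightarrow> real) \<Rightarrow> 'a measure" where
  "lower_variation M \<mu> = upper_variation M (\<lambda>A. - \<mu> A)"

definition signed_integral :: "'a measure \<Rightarrow> ('a set \<Rightarrow> real) \<Rightarrow> ('a \<Rightarrow> complex) \<Rightarrow> complex" where
  "signed_integral M \<mu> f =
     integral\<^sup>L (upper_variation M \<mu>) f - integral\<^sup>L (lower_variation M \<mu>) f"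

definition complex_integral :: "'a measure \<Rightarrow> ('a set \<Rightarrow> complex) \<Rightarrow> ('a \<Rightarrow> complex) \<Rightarrow> complex" where
  "complex_integral M \<nu> f =
     signed_integral M (\<lambda>A. Re (\<nu> A)) f + \<i> * signed_integral M (\<lambda>A. Im (\<nu> A)) f"

section \<open>Herglotz and quasi-Herglotz functions\<close>

text \<open>Functions on \<open>\<complex> \<setminus> \<real>\<close> are total functions on \<open>\<complex>\<close> whose values on \<open>\<real>\<close> are
  irrelevant; \<open>- \<real>\<close> is the complement of the real line.\<close>

definition herglotz :: "(complex \<Rightarrow> complex) \<Rightarrow> bool" where
  "herglotz h \<longleftrightarrow>
     h holomorphic_on (- \<real>) \<and>
     (\<forall>z \<in> - \<real>. Im (h z) / Im z \<ge> 0 \<and> cnj (h z) = h (cnj z))"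

definition quasi_herglotz :: "(complex \<Rightarrow> complex) \<Rightarrow> bool" where
  "quasi_herglotz q \<longleftrightarrow>
     (\<exists>h1 h2 h3 h4. herglotz h1 \<and> herglotz h2 \<and> herglotz h3 \<and> herglotz h4 \<and>
        (\<forall>z \<in> - \<real>. q z = (h1 z - h2 z) + \<i> * (h3 z - h4 z)))"

definition quasi_herglotz_data ::
    "(complex \<Rightarrow> complex) \<Rightarrow> complex \<Rightarrow> complex \<Rightarrow> (real set \<Rightarrow> complex) \<Rightarrow> bool" where
  "quasi_herglotz_data q a b \<nu> \<longleftrightarrow>
     complex_measure (borel :: real measure) \<nu> \<and>
     (\<forall>z \<in> - \<real>. q z = a + b * z +
        1 / of_real pi *
          complex_integral borel \<nu> (\<lambda>t. (1 + of_real t * z) / (of_real t - z)))"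

section \<open>The Cauchy transform on the Riemann sphere\<close>

text \<open>As in \<^const>\<open>Alexandroff_compactification\<close>, the added point \<open>\<infinity>\<close> is \<^const>\<open>None\<close>.\<close>

type_synonym riemann_sphere = "complex option"

definition circle_borel :: "complex measure" where
  "circle_borel = restrict_space borel (sphere 0 1)"

text \<open>The Cauchy transform is only meaningful off the unit circle.\<close>

definition cauchy_transform :: "(complex set \<Rightarrow> complex) \<Rightarrow> riemann_sphere \<Rightarrow> complex" where
  "cauchy_transform \<sigma> p =
     (case p of
        None \<Rightarrow> 0
      | Some \<tau> \<Rightarrow> complex_integral circle_borel \<sigma> (\<lambda>\<zeta>. 1 / (1 - cnj \<zeta> * \<tau>)))"

definition inverse_cayley :: "riemann_sphere \<Rightarrow> riemann_sphere" where
  "inverse_cayley p =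
     (case p of
        None \<Rightarrow> Some 1
      | Some z \<Rightarrow> if z = - \<i> then None else Some ((z - \<i>) / (z + \<i>)))"

definition cauchy_representation ::
    "(complex \<Rightarrow> complex) \<Rightarrow> complex \<Rightarrow> (complex set \<Rightarrow> complex) \<Rightarrow> bool" where
  "cauchy_representation q c \<sigma> \<longleftrightarrow>
     complex_measure circle_borel \<sigma> \<and>
     (\<forall>z \<in> - \<real>. q z = c + cauchy_transform \<sigma> (inverse_cayley (Some z)))"

end

theory Submission
  imports Defs "HOL-Probability.Helly_Selection"
begin

text \<open>
  Both directions pass through the kernel \<open>K z u = \<i> (u + w) / (u - w)\<close> with \<open>w = (z - \<i>) / (z + \<i>)\<close>,
  which is the Herglotz kernel of the disc in the coordinate of the half-planes. On \<open>\<bar>u\<bar> = 1\<close> the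
  Cauchy kernel at \<open>w\<close> is \<open>(1 - \<i> K z u) / 2\<close>, even at \<open>z = -\<i>\<close>, where \<open>K = -\<i>\<close> and the Cauchy
  transform at \<open>\<infinity>\<close> is \<open>0\<close>. So the Cauchy transforms of measures at \<open>w\<close> and the functions \<open>\<integral> K z u \<partial>P(u)\<close>
  for finite positive measures \<open>P\<close> determine each other up to additive constants, and the theorem
  reduces to the fact that the functions \<open>a + 1/2 \<integral> K z u \<partial>P\<close> with real \<open>a\<close> are exactly the
  Herglotz functions.

  From Cauchy transforms to quasi-Herglotz functions
  (\<open>quasi_herglotz_if_cauchy_representation\<close>): a complex measure is bounded, so the integral against
  it is a combination of integrals against four finite positive measures. For each of these,
  \<open>\<integral> K z u \<partial>P\<close> is a Herglotz function because \<open>Im K\<close> has the sign of \<open>Im z\<close> and \<open>K\<close> is symmetric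
  under conjugation. The factor \<open>-\<i>\<close> between the two kernels only permutes the four functions in the
  definition of a quasi-Herglotz function, which also absorbs any complex constant.

  Conversely (\<open>cauchy_representation_if_quasi_herglotz\<close>), every Herglotz function \<open>h\<close> equals
  \<open>Re h(\<i>) + 1/2 \<integral> K z u \<partial>P\<close>. For \<open>f(w) = -\<i> h(z)\<close>, a function with \<open>Re f \<ge> 0\<close> on the disc, the Schwarz
  integral formula on circles of radius \<open>r < 1\<close> expresses \<open>f(r w)\<close> by the measures with density
  \<open>Re f(r u)\<close>, which all have total mass \<open>Re f(0)\<close>; by Helly selection they converge weakly along a
  sequence \<open>r \<rightarrow> 1\<close>. Four such measures are combined to a complex measure, and the integral against
  it, defined by upper and lower variations, is the expected combination of integrals by a Hahn
  decomposition.

  The value of \<open>c\<close> is read off at \<open>z = -\<i>\<close>, where the Cauchy transform vanishes and the kernel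
  \<open>(1 + t z) / (t - z)\<close> of the data is the constant \<open>-\<i>\<close>.
\<close>

section \<open>Boundedness of complex measures\<close>

lemma complex_measure_Un:
  assumes "complex_measure M \<nu>" "A \<in> sets M" "B \<in> sets M" "A \<inter> B = {}"
  shows "\<nu> (A \<union> B) = \<nu> A + \<nu> B"
proof -
  have "disjoint_family (binaryset A B)"
    using assms(4) by (auto simp: disjoint_family_on_def binaryset_def)
  moreover have "range (binaryset A B) \<subseteq> sets M"
    using assms(2,3) by (simp add: range_binaryset_eq)
  ultimately have "(\<lambda>i. \<nu> (binaryset A B i)) sums \<nu> (\<Union>i. binaryset A B i)"
    using assms(1) unfolding complex_measure_def by blast
  moreover have "(\<lambda>i. \<nu> (binaryset A B i)) sums (\<nu> A + \<nu> B)"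
    using assms by (intro binaryset_sums) (simp add: complex_measure_def)
  ultimately show ?thesis
    by (simp add: UN_binaryset_eq sums_unique2)
qed

text \<open>If \<open>\<nu>\<close> is unbounded on the subsets of \<open>A\<close>, then \<open>A\<close> splits into two parts such that
  \<open>\<nu>\<close> has modulus at least \<open>1\<close> on one and is again unbounded on the subsets of the other. Iterating
  this yields infinitely many disjoint sets with \<open>\<bar>\<nu>\<bar> \<ge> 1\<close>, although the values of \<open>\<nu>\<close> on disjoint
  sets form a convergent series.\<close>

lemma complex_measure_bounded:
  assumes \<nu>: "complex_measure M \<nu>"
  obtains B where "\<And>A. A \<in> sets M \<Longrightarrow> norm (\<nu> A) \<le> B"
proof -
  define bad where "bad A \<longleftrightarrow> A \<in> sets M \<and> (\<forall>B. \<exists>C\<in>sets M. C \<subseteq> A \<and> norm (\<nu> C) > B)" for A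
  have split: "\<exists>A'. bad A' \<and> A' \<subseteq> A \<and> norm (\<nu> (A - A')) \<ge> 1" if "bad A" for A
  proof -
    from that have A: "A \<in> sets M" by (simp add: bad_def)
    from that obtain C where C: "C \<in> sets M" "C \<subseteq> A" "norm (\<nu> C) > norm (\<nu> A) + 1"
      by (auto simp: bad_def)
    have AC: "A - C \<in> sets M" using A C by auto
    have "\<nu> A = \<nu> C + \<nu> (A - C)"
      using complex_measure_Un[OF \<nu> C(1) AC] C(2) by (simp add: Un_absorb1)
    hence big: "norm (\<nu> (A - C)) \<ge> 1"
      using C(3) norm_triangle_ineq4[of "\<nu> A" "\<nu> (A - C)"] norm_triangle_ineq2[of "\<nu> C" "\<nu> A"]
      by (simp add: norm_minus_commute)
    have "bad C \<or> bad (A - C)"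
    proof (rule ccontr)
      assume "\<not> ?thesis"
      then obtain B1 B2 where
        B: "\<And>X. X \<in> sets M \<Longrightarrow> X \<subseteq> C \<Longrightarrow> norm (\<nu> X) \<le> B1"
           "\<And>X. X \<in> sets M \<Longrightarrow> X \<subseteq> A - C \<Longrightarrow> norm (\<nu> X) \<le> B2"
        using C(1) AC unfolding bad_def by (metis linorder_not_le)
      from that obtain X where X: "X \<in> sets M" "X \<subseteq> A" "norm (\<nu> X) > B1 + B2"
        by (auto simp: bad_def)
      have XC: "X \<inter> C \<in> sets M" "X - C \<in> sets M" using X C by auto
      have "\<nu> X = \<nu> (X \<inter> C) + \<nu> (X - C)"
        using complex_measure_Un[OF \<nu> XC] by (simp add: Int_Diff_Un Int_Diff_disjoint)
      moreover have "norm (\<nu> (X \<inter> C)) \<le> B1" "norm (\<nu> (X - C)) \<le> B2"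
        using B(1)[OF XC(1)] B(2)[OF XC(2)] X(2) by auto
      ultimately have "norm (\<nu> X) \<le> B1 + B2"
        using norm_triangle_le[of "\<nu> (X \<inter> C)" "\<nu> (X - C)" "B1 + B2"] by simp
      with X(3) show False by simp
    qed
    moreover have "norm (\<nu> C) \<ge> 1" using C(3) norm_ge_zero[of "\<nu> A"] by linarith
    moreover have "A - (A - C) = C" using C(2) by auto
    ultimately show ?thesis
      using big C(2) by (metis Diff_subset)
  qed
  have "\<not> bad (space M)"
  proof
    assume "bad (space M)"
    then have "\<exists>A. \<forall>n. (bad (A n) \<and> (n = 0 \<longrightarrow> A n = space M)) \<and>
        A (Suc n) \<subseteq> A n \<and> norm (\<nu> (A n - A (Suc n))) \<ge> 1"
    proof (intro dependent_nat_choice)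
      show "\<exists>X. bad X \<and> (0 = 0 \<longrightarrow> X = space M)"
        using \<open>bad (space M)\<close> by blast
      fix X and n :: nat assume "bad X \<and> (n = 0 \<longrightarrow> X = space M)"
      then show "\<exists>Y. (bad Y \<and> (Suc n = 0 \<longrightarrow> Y = space M)) \<and> Y \<subseteq> X \<and> norm (\<nu> (X - Y)) \<ge> 1"
        using split[of X] by blast
    qed
    then obtain A where A: "\<And>n. bad (A n)"
        "\<And>n. A (Suc n) \<subseteq> A n \<and> norm (\<nu> (A n - A (Suc n))) \<ge> 1"
      by blast
    define D where "D n = A n - A (Suc n)" for n
    have anti: "A n \<subseteq> A m" if "m \<le> n" for m n
      using that
    proof (induction rule: dec_induct)
      case (step n)
      then show ?case using A(2)[of n] by blast
    qed simp
    have disj: "D m \<inter> D n = {}" if "m < n" for m n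
      using anti[of "Suc m" n] that unfolding D_def by auto
    have "disjoint_family D"
      unfolding disjoint_family_on_def
    proof (intro ballI impI)
      fix m n :: nat assume "m \<noteq> n"
      then show "D m \<inter> D n = {}" using disj[of m n] disj[of n m] by (cases "m < n") auto
    qed
    moreover have "range D \<subseteq> sets M"
      using A(1) by (auto simp: D_def bad_def)
    ultimately have "summable (\<lambda>n. \<nu> (D n))"
      using \<nu> unfolding complex_measure_def by (blast intro: sums_summable)
    hence "(\<lambda>n. norm (\<nu> (D n))) \<longlonglongrightarrow> 0"
      using summable_LIMSEQ_zero tendsto_norm_zero by blast
    moreover have "norm (\<nu> (D n)) \<ge> 1" for n using A(2) by (simp add: D_def)
    ultimately show False
      using LIMSEQ_le_const[of "\<lambda>n. norm (\<nu> (D n))" 0 1] by force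
  qed
  then obtain B where "\<And>C. C \<in> sets M \<Longrightarrow> norm (\<nu> C) \<le> B"
    unfolding bad_def using sets.sets_into_space by (metis linorder_not_le sets.top)
  then show thesis by (rule that)
qed

section \<open>Decomposing the integral against a complex measure\<close>

lemma sets_upper_variation: "sets (upper_variation M \<mu>) = sets M"
  by (simp add: upper_variation_def)

lemma sets_lower_variation: "sets (lower_variation M \<mu>) = sets M"
  by (simp add: lower_variation_def sets_upper_variation)

text \<open>The total mass is the supremum of the positive part of \<open>\<mu>\<close>, or \<open>0\<close> in case the set function of the definition is not
  countably additive, since \<^const>\<open>measure_of\<close> then yields the null measure.\<close>

lemma finite_measure_upper_variation:
  assumes "\<And>A. A \<in> sets M \<Longrightarrow> \<mu> A \<le> B"
  shows "finite_measure (upper_variation M \<mu>)"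
proof
  have "(SUP A\<in>{A \<in> sets M. A \<subseteq> space M}. ennreal (\<mu> A)) \<le> ennreal B"
    using assms by (intro SUP_least) (auto intro: ennreal_leI)
  hence "(SUP A\<in>{A \<in> sets M. A \<subseteq> space M}. ennreal (\<mu> A)) < top"
    using ennreal_less_top le_less_trans by blast
  hence "emeasure (upper_variation M \<mu>) (space M) < top"
    unfolding upper_variation_def emeasure_measure_of_conv by auto
  moreover have "space (upper_variation M \<mu>) = space M"
    by (simp add: upper_variation_def)
  ultimately show "emeasure (upper_variation M \<mu>) (space (upper_variation M \<mu>)) \<noteq> \<infinity>"
    by simp
qed

lemma complex_integral_decomposition:
  assumes "complex_measure M \<nu>"
  obtains P N P' N' :: "'a measure"
  where "finite_measure P" "finite_measure N" "finite_measure P'" "finite_measure N'"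
    and "sets P = sets M" "sets N = sets M" "sets P' = sets M" "sets N' = sets M"
    and "\<And>f. complex_integral M \<nu> f =
           (integral\<^sup>L P f - integral\<^sup>L N f) + \<i> * (integral\<^sup>L P' f - integral\<^sup>L N' f)"
proof -
  obtain B where B: "\<And>A. A \<in> sets M \<Longrightarrow> norm (\<nu> A) \<le> B"
    using complex_measure_bounded[OF assms] by blast
  have fin: "finite_measure (upper_variation M \<mu>)" if "\<And>A. \<mu> A \<le> norm (\<nu> A)" for \<mu>
    using B that by (intro finite_measure_upper_variation[of M \<mu> B]) (meson order_trans)
  have le: "Re z \<le> norm z" "- Re z \<le> norm z" "Im z \<le> norm z" "- Im z \<le> norm z" for z
    using abs_Re_le_cmod[of z] abs_Im_le_cmod[of z] by linarith+
  show thesis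
    by (rule that[of "upper_variation M (\<lambda>A. Re (\<nu> A))" "lower_variation M (\<lambda>A. Re (\<nu> A))"
          "upper_variation M (\<lambda>A. Im (\<nu> A))" "lower_variation M (\<lambda>A. Im (\<nu> A))"])
       (auto simp: sets_upper_variation sets_lower_variation lower_variation_def
          complex_integral_def signed_integral_def intro!: fin le)
qed

text \<open>The integral of a simple function is a linear combination of measures of sets, and a bounded
  function is a dominated limit of simple functions. Stating additivity in the form
  \<open>A + B = C + D\<close> avoids forming sums of measures.\<close>

lemma integral_add_finite_measures:
  fixes f :: "'a \<Rightarrow> complex"
  assumes fin: "finite_measure A" "finite_measure B" "finite_measure C" "finite_measure D"
    and sets: "sets B = sets A" "sets C = sets A" "sets D = sets A"
    and eq: "\<And>X. X \<in> sets A \<Longrightarrow> measure A X + measure B X = measure C X + measure D X"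
    and f: "f \<in> borel_measurable A" and bd: "\<And>x. x \<in> space A \<Longrightarrow> norm (f x) \<le> K"
  shows "integral\<^sup>L A f + integral\<^sup>L B f = integral\<^sup>L C f + integral\<^sup>L D f"
proof -
  obtain s where s: "\<And>i. simple_function A (s i)" "\<And>x. x \<in> space A \<Longrightarrow> (\<lambda>i. s i x) \<longlonglongrightarrow> f x"
      "\<And>i x. x \<in> space A \<Longrightarrow> norm (s i x) \<le> 2 * norm (f x)"
    using borel_measurable_implies_sequence_metric[OF f, of 0] by (simp add: dist_norm) metis
  have lim: "(\<lambda>i. integral\<^sup>L M (s i)) \<longlonglongrightarrow> integral\<^sup>L M f"
    and int: "integral\<^sup>L M (s i) = (\<Sum>y\<in>s i ` space A. measure M {x \<in> space A. s i x = y} *\<^sub>R y)"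
    if M: "finite_measure M" "sets M = sets A" for M i
  proof -
    interpret M: finite_measure M by fact
    note sp = sets_eq_imp_space_eq[OF M(2)]
    have sM: "simple_function M (s i)" for i
      using s(1)[of i] M(2) sp by (simp add: simple_function_def)
    show "(\<lambda>i. integral\<^sup>L M (s i)) \<longlonglongrightarrow> integral\<^sup>L M f"
    proof (rule integral_dominated_convergence[where w = "\<lambda>_. 2 * K"])
      show "f \<in> borel_measurable M" using f M(2) measurable_cong_sets by blast
      show "s i \<in> borel_measurable M" for i using sM by (rule borel_measurable_simple_function)
      show "AE x in M. norm (s i x) \<le> 2 * K" for i
        using s(3) bd sp by (intro AE_I2) (smt (verit))
    qed (use s sp in auto)
    have "Bochner_Integration.simple_bochner_integrable M (s i)"
      using sM by (simp add: simple_bochner_integrable.simps)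
    thus "integral\<^sup>L M (s i) = (\<Sum>y\<in>s i ` space A. measure M {x \<in> space A. s i x = y} *\<^sub>R y)"
      using simple_bochner_integrable_eq_integral[of M "s i"] sp
      by (simp add: Bochner_Integration.simple_bochner_integral_def)
  qed
  have "integral\<^sup>L A (s i) + integral\<^sup>L B (s i) = integral\<^sup>L C (s i) + integral\<^sup>L D (s i)" for i
  proof -
    have "measure A {x \<in> space A. s i x = y} + measure B {x \<in> space A. s i x = y} =
        measure C {x \<in> space A. s i x = y} + measure D {x \<in> space A. s i x = y}" for y
      using s(1)[of i] by (intro eq) (auto dest: simple_functionD(2)[of A "s i" "{y}"] simp: vimage_def Int_def conj_commute)
    thus ?thesis
      using fin sets by (simp add: int sum.distrib[symmetric] scaleR_add_left[symmetric])
  qed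
  hence "(\<lambda>i. integral\<^sup>L A (s i) + integral\<^sup>L B (s i)) \<longlonglongrightarrow> integral\<^sup>L C f + integral\<^sup>L D f"
    using fin sets by (auto intro!: tendsto_add lim)
  moreover have "(\<lambda>i. integral\<^sup>L A (s i) + integral\<^sup>L B (s i)) \<longlonglongrightarrow> integral\<^sup>L A f + integral\<^sup>L B f"
    using fin sets by (auto intro!: tendsto_add lim)
  ultimately show ?thesis using LIMSEQ_unique by blast
qed

text \<open>On a positive set \<open>Y\<close> of a Hahn decomposition of \<open>A - B\<close> the supremum in the upper variation is
  attained at \<open>X \<inter> Y\<close>, so that the upper variation is the measure \<open>A - B\<close> restricted to \<open>Y\<close>.\<close>

lemma upper_variation_diff:
  assumes fin: "finite_measure A" "finite_measure B" and sets: "sets A = sets M" "sets B = sets M"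
    and Y: "Y \<in> sets M"
    and pos: "\<forall>X\<in>sets M. X \<subseteq> Y \<longrightarrow> emeasure B X \<le> emeasure A X"
    and neg: "\<forall>X\<in>sets M. X \<inter> Y = {} \<longrightarrow> emeasure A X \<le> emeasure B X"
  shows "finite_measure (upper_variation M (\<lambda>X. measure A X - measure B X))"
    and "X \<in> sets M \<Longrightarrow> measure (upper_variation M (\<lambda>X. measure A X - measure B X)) X =
           measure A (X \<inter> Y) - measure B (X \<inter> Y)"
proof -
  interpret A: finite_measure A by fact
  interpret B: finite_measure B by fact
  note [measurable_cong] = sets
  note [measurable] = Y
  define D where "D = diff_measure (density A (indicator Y)) (density B (indicator Y))"
  have emA: "emeasure (density A (indicator Y)) X = emeasure A (X \<inter> Y)" if "X \<in> sets M" for X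
    using that sets Y by (subst emeasure_density) (auto simp: Int_commute nn_integral_indicator[symmetric] indicator_inter_arith mult.commute simp del: nn_integral_indicator)
  have emB: "emeasure (density B (indicator Y)) X = emeasure B (X \<inter> Y)" if "X \<in> sets M" for X
    using that sets Y by (subst emeasure_density) (auto simp: Int_commute nn_integral_indicator[symmetric] indicator_inter_arith mult.commute simp del: nn_integral_indicator)
  have sp: "space A = space M" "space B = space M"
    using sets[THEN sets_eq_imp_space_eq] by auto
  have fA: "finite_measure (density A (indicator Y))"
    by (rule finite_measureI) (simp add: emA sp)
  have fB: "finite_measure (density B (indicator Y))"
    by (rule finite_measureI) (simp add: emB sp)
  have emD: "emeasure D X = ennreal (measure A (X \<inter> Y) - measure B (X \<inter> Y))" if "X \<in> sets M" for X
    using that pos Y unfolding D_def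
    by (subst emeasure_diff_measure[OF fA fB]) (auto simp: sets emA emB A.emeasure_eq_measure B.emeasure_eq_measure ennreal_minus)
  have SUP: "(SUP C\<in>{C \<in> sets M. C \<subseteq> X}. ennreal (measure A C - measure B C)) = emeasure D X"
    if X: "X \<in> sets M" for X
  proof (rule antisym)
    show "emeasure D X \<le> (SUP C\<in>{C \<in> sets M. C \<subseteq> X}. ennreal (measure A C - measure B C))"
      unfolding emD[OF X] using X Y by (intro SUP_upper) auto
    show "(SUP C\<in>{C \<in> sets M. C \<subseteq> X}. ennreal (measure A C - measure B C)) \<le> emeasure D X"
      unfolding emD[OF X]
    proof (intro SUP_least ennreal_leI)
      fix C assume "C \<in> {C \<in> sets M. C \<subseteq> X}"
      hence C: "C \<in> sets M" "C \<subseteq> X" by auto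
      let ?R = "(X - C) \<inter> Y"
      have m: "C - Y \<in> sets M" "?R \<in> sets M" "C \<inter> Y \<in> sets M" using C Y X by auto
      have "measure A (C - Y) \<le> measure B (C - Y)"
        using neg m(1) by (auto simp: A.emeasure_eq_measure B.emeasure_eq_measure)
      moreover have "measure B ?R \<le> measure A ?R"
        using pos m(2) by (auto simp: A.emeasure_eq_measure B.emeasure_eq_measure)
      moreover have "measure A C = measure A (C \<inter> Y) + measure A (C - Y)"
        using m sets by (subst A.finite_measure_Union[symmetric]) (auto simp: Int_Diff_Un Int_Diff_disjoint)
      moreover have "measure B C = measure B (C \<inter> Y) + measure B (C - Y)"
        using m sets by (subst B.finite_measure_Union[symmetric]) (auto simp: Int_Diff_Un Int_Diff_disjoint)
      moreover have XY: "X \<inter> Y = (C \<inter> Y) \<union> ?R" using C by auto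
      have "measure A (X \<inter> Y) = measure A (C \<inter> Y) + measure A ?R"
        using m sets unfolding XY by (subst A.finite_measure_Union[symmetric]) auto
      moreover have "measure B (X \<inter> Y) = measure B (C \<inter> Y) + measure B ?R"
        using m sets unfolding XY by (subst B.finite_measure_Union[symmetric]) auto
      ultimately show "measure A C - measure B C \<le> measure A (X \<inter> Y) - measure B (X \<inter> Y)"
        by linarith
    qed
  qed
  \<comment> \<open>The set function in the definition agrees with a measure on all measurable sets, hence it is
      itself countably additive and defines that measure.\<close>
  have "upper_variation M (\<lambda>X. measure A X - measure B X) = measure_of (space M) (sets M) (emeasure D)"
    unfolding upper_variation_def by (rule measure_of_eq) (simp_all add: SUP sets.space_closed sets.sigma_sets_eq)
  also have "\<dots> = D"
    using measure_of_of_measure[of D] by (simp add: D_def sets sp)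
  finally have UD: "upper_variation M (\<lambda>X. measure A X - measure B X) = D" .
  have "space D = space M" by (simp add: D_def sp)
  then show "finite_measure (upper_variation M (\<lambda>X. measure A X - measure B X))"
    unfolding UD by (intro finite_measureI) (simp add: emD)
  show "measure (upper_variation M (\<lambda>X. measure A X - measure B X)) X =
           measure A (X \<inter> Y) - measure B (X \<inter> Y)" if X: "X \<in> sets M"
  proof -
    have "measure B (X \<inter> Y) \<le> measure A (X \<inter> Y)"
      using pos X Y by (auto simp: A.emeasure_eq_measure B.emeasure_eq_measure)
    thus ?thesis unfolding UD using measure_eq_emeasure_eq_ennreal[of _ D X] emD[OF X] by simp
  qed
qed

text \<open>The Jordan decomposition of \<open>A - B\<close> is in general smaller than the pair \<open>A\<close>, \<open>B\<close>, but bounded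
  functions have the same difference of integrals against both.\<close>

lemma signed_integral_diff:
  fixes f :: "'a \<Rightarrow> complex"
  assumes fin: "finite_measure A" "finite_measure B" and sets: "sets A = sets M" "sets B = sets M"
    and f: "f \<in> borel_measurable M" and bd: "\<And>x. x \<in> space M \<Longrightarrow> norm (f x) \<le> K"
  shows "signed_integral M (\<lambda>X. measure A X - measure B X) f = integral\<^sup>L A f - integral\<^sup>L B f"
proof -
  interpret A: finite_measure A by fact
  interpret B: finite_measure B by fact
  obtain Y where Y: "Y \<in> sets M"
    and pos: "\<forall>X\<in>sets M. X \<subseteq> Y \<longrightarrow> emeasure B X \<le> emeasure A X"
    and neg: "\<forall>X\<in>sets M. X \<inter> Y = {} \<longrightarrow> emeasure A X \<le> emeasure B X"
    using finite_unsigned_Hahn_decomposition[OF fin] sets by auto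
  let ?U = "upper_variation M (\<lambda>X. measure A X - measure B X)"
  let ?L = "upper_variation M (\<lambda>X. measure B X - measure A X)"
  note U = upper_variation_diff[OF fin sets Y pos neg]
  have neg': "\<forall>X\<in>sets M. X \<subseteq> space M - Y \<longrightarrow> emeasure A X \<le> emeasure B X"
    using neg by blast
  have pos': "\<forall>X\<in>sets M. X \<inter> (space M - Y) = {} \<longrightarrow> emeasure B X \<le> emeasure A X"
    using pos sets.sets_into_space by blast
  have "space M - Y \<in> sets M" using Y by auto
  note L = upper_variation_diff[OF fin(2,1) sets(2,1) this neg' pos']
  have "integral\<^sup>L ?U f + integral\<^sup>L B f = integral\<^sup>L ?L f + integral\<^sup>L A f"
  proof (rule integral_add_finite_measures[where K = K])
    fix X assume "X \<in> sets ?U"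
    hence X: "X \<in> sets M" by (simp add: sets_upper_variation)
    have eq: "X \<inter> (space M - Y) = X - Y" using sets.sets_into_space[OF X] by auto
    have m: "X \<inter> Y \<in> sets M" "X - Y \<in> sets M" using X Y by auto
    have "measure A X = measure A (X \<inter> Y) + measure A (X - Y)"
      using m sets by (subst A.finite_measure_Union[symmetric]) (auto simp: Int_Diff_Un Int_Diff_disjoint)
    moreover have "measure B X = measure B (X \<inter> Y) + measure B (X - Y)"
      using m sets by (subst B.finite_measure_Union[symmetric]) (auto simp: Int_Diff_Un Int_Diff_disjoint)
    ultimately show "measure ?U X + measure B X = measure ?L X + measure A X"
      using U(2)[OF X] L(2)[OF X] by (simp add: eq)
  next
    show "f \<in> borel_measurable ?U"
      using f measurable_cong_sets[OF sets_upper_variation refl] by blast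
    show "norm (f x) \<le> K" if "x \<in> space ?U" for x
      using that bd sets_eq_imp_space_eq[OF sets_upper_variation[of M]] by auto
  qed (use U(1) L(1) fin sets in \<open>auto simp: sets_upper_variation\<close>)
  then show ?thesis
    unfolding signed_integral_def lower_variation_def by (simp add: algebra_simps)
qed

lemma complex_integral_of_differences:
  fixes f :: "'a \<Rightarrow> complex"
  assumes fin: "finite_measure A" "finite_measure B" "finite_measure C" "finite_measure D"
    and sets: "sets A = sets M" "sets B = sets M" "sets C = sets M" "sets D = sets M"
  defines "\<sigma> \<equiv> \<lambda>X. Complex (measure A X - measure B X) (measure C X - measure D X)"
  shows "complex_measure M \<sigma>"
    and "f \<in> borel_measurable M \<Longrightarrow> (\<And>x. x \<in> space M \<Longrightarrow> norm (f x) \<le> K) \<Longrightarrow>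
      complex_integral M \<sigma> f =
        (integral\<^sup>L A f - integral\<^sup>L B f) + \<i> * (integral\<^sup>L C f - integral\<^sup>L D f)"
proof -
  show "complex_measure M \<sigma>"
    unfolding complex_measure_def
  proof (intro conjI allI impI)
    fix X :: "nat \<Rightarrow> 'a set" assume X: "range X \<subseteq> sets M" "disjoint_family X"
    have "(\<lambda>i. measure N (X i)) sums measure N (\<Union>i. X i)" if "finite_measure N" "sets N = sets M" for N
      using finite_measure.finite_measure_UNION[OF that(1)] X that(2) by simp
    then show "(\<lambda>i. \<sigma> (X i)) sums \<sigma> (\<Union>i. X i)"
      using fin sets unfolding \<sigma>_def by (auto simp: sums_complex_iff intro!: sums_diff)
  qed (simp add: \<sigma>_def complex_eq_iff)
  assume "f \<in> borel_measurable M" "\<And>x. x \<in> space M \<Longrightarrow> norm (f x) \<le> K"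
  then show "complex_integral M \<sigma> f =
        (integral\<^sup>L A f - integral\<^sup>L B f) + \<i> * (integral\<^sup>L C f - integral\<^sup>L D f)"
    using fin sets unfolding complex_integral_def \<sigma>_def
    by (simp add: signed_integral_diff[where K = K])
qed

section \<open>The Herglotz kernel in half-plane coordinates\<close>

text \<open>With \<open>w = (z - \<i>) / (z + \<i>)\<close> this is \<open>\<i> (u + w) / (u - w)\<close>. Clearing the denominator of \<open>w\<close>
  makes the formula valid at \<open>z = -\<i>\<close>, that is for \<open>w = \<infinity>\<close>.\<close>

definition herglotz_kernel :: "complex \<Rightarrow> complex \<Rightarrow> complex" where
  "herglotz_kernel z u = \<i> * (u * (z + \<i>) + (z - \<i>)) / (u * (z + \<i>) - (z - \<i>))"

lemma not_real_iff_Im_nonzero: "z \<in> - \<real> \<longleftrightarrow> Im z \<noteq> 0"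
  by (simp add: complex_is_Real_iff)

lemma cmod_plus_i_ne_minus_i: "Im z \<noteq> 0 \<Longrightarrow> norm (z + \<i>) \<noteq> norm (z - \<i>)"
proof
  assume "Im z \<noteq> 0" "norm (z + \<i>) = norm (z - \<i>)"
  then have "(norm (z + \<i>))\<^sup>2 = (norm (z - \<i>))\<^sup>2" by simp
  then show False using \<open>Im z \<noteq> 0\<close> unfolding cmod_power2
    by (simp add: power2_eq_square algebra_simps)
qed

text \<open>Off the real line the two moduli differ, so this bounds the denominator away from \<open>0\<close>
  uniformly on the circle and locally uniformly in \<open>z\<close>. All estimates of the kernel rest on it.\<close>

lemma herglotz_kernel_denominator_bound:
  assumes "norm u = 1"
  shows "\<bar>norm (z + \<i>) - norm (z - \<i>)\<bar> \<le> norm (u * (z + \<i>) - (z - \<i>))"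
  using norm_triangle_ineq3[of "u * (z + \<i>)" "z - \<i>"] assms by (simp add: norm_mult)

lemma herglotz_kernel_denominator_nonzero:
  assumes "norm u = 1" "Im z \<noteq> 0"
  shows "u * (z + \<i>) - (z - \<i>) \<noteq> 0"
  using herglotz_kernel_denominator_bound[OF assms(1), of z] cmod_plus_i_ne_minus_i[OF assms(2)] by auto

lemma cauchy_kernel_eq_herglotz_kernel:
  assumes u: "norm u = 1" and z: "Im z \<noteq> 0" "z \<noteq> - \<i>"
  shows "1 / (1 - cnj u * ((z - \<i>) / (z + \<i>))) = (1 - \<i> * herglotz_kernel z u) / 2"
proof -
  have u1: "u * cnj u = 1" using u by (simp add: complex_norm_square[symmetric])
  have nz: "z + \<i> \<noteq> 0" "u \<noteq> 0" "u * (z + \<i>) - (z - \<i>) \<noteq> 0"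
    using z(2) u herglotz_kernel_denominator_nonzero[OF u z(1)] eq_neg_iff_add_eq_0[of z \<i>] by auto
  have "u * (z + \<i>) * (1 - cnj u * ((z - \<i>) / (z + \<i>))) = u * (z + \<i>) - (u * cnj u) * (z - \<i>)"
    using nz(1) by (simp add: field_simps)
  then have "1 - cnj u * ((z - \<i>) / (z + \<i>)) = (u * (z + \<i>) - (z - \<i>)) / (u * (z + \<i>))"
    using nz by (simp add: nonzero_eq_divide_eq u1 mult.commute del: eq_divide_eq)
  then have "1 / (1 - cnj u * ((z - \<i>) / (z + \<i>))) = u * (z + \<i>) / (u * (z + \<i>) - (z - \<i>))"
    by simp
  also have "\<dots> = (1 - \<i> * herglotz_kernel z u) / 2"
  proof -
    define D where "D = u * (z + \<i>) - (z - \<i>)"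
    have "u * (z + \<i>) + (z - \<i>) = 2 * (u * (z + \<i>)) - D" by (simp add: D_def)
    then have "herglotz_kernel z u = \<i> * (2 * (u * (z + \<i>)) - D) / D"
      by (simp add: herglotz_kernel_def D_def)
    then have "\<i> * herglotz_kernel z u = - ((2 * (u * (z + \<i>)) - D) / D)"
      by (simp add: mult.assoc[symmetric] minus_divide_left)
    also have "\<dots> = 1 - 2 * (u * (z + \<i>) / D)" using nz(3) by (simp add: D_def[symmetric] diff_divide_distrib)
    finally have "u * (z + \<i>) / D = (1 - \<i> * herglotz_kernel z u) / 2" by simp
    then show ?thesis unfolding D_def .
  qed
  finally show ?thesis .
qed

lemma herglotz_kernel_minus_i: "norm u = 1 \<Longrightarrow> herglotz_kernel (- \<i>) u = - \<i>"
  by (simp add: herglotz_kernel_def)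

lemma Im_herglotz_kernel:
  assumes "norm u = 1" "Im z \<noteq> 0"
  shows "Im (herglotz_kernel z u) = 4 * Im z / (norm (u * (z + \<i>) - (z - \<i>)))\<^sup>2"
proof -
  let ?N = "u * (z + \<i>) + (z - \<i>)" and ?D = "u * (z + \<i>) - (z - \<i>)"
  have u: "(Re u)\<^sup>2 + (Im u)\<^sup>2 = 1" using assms(1) by (simp add: cmod_power2[symmetric])
  have "Re ?N * Re ?D + Im ?N * Im ?D = 
     ((Re u)\<^sup>2 + (Im u)\<^sup>2) * ((Re z)\<^sup>2 + (Im z + 1)\<^sup>2) - ((Re z)\<^sup>2 + (Im z - 1)\<^sup>2)"
    by (simp add: power2_eq_square algebra_simps)
  also have "\<dots> = 4 * Im z" unfolding u by (simp add: power2_eq_square algebra_simps)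
  finally have "Re ?N * Re ?D + Im ?N * Im ?D = 4 * Im z" .
  moreover have "Im (\<i> * N / D) = (Re N * Re D + Im N * Im D) / (norm D)\<^sup>2" for N D
    by (simp add: Im_divide cmod_power2)
  ultimately show ?thesis
    unfolding herglotz_kernel_def by simp
qed

lemma cnj_herglotz_kernel:
  assumes "norm u = 1" "Im z \<noteq> 0"
  shows "cnj (herglotz_kernel z u) = herglotz_kernel (cnj z) u"
proof -
  have u1: "u * cnj u = 1" using assms(1) by (simp add: complex_norm_square[symmetric])
  have "u \<noteq> 0" using assms(1) by auto
  have "cnj (herglotz_kernel z u) =
      (u * (- \<i> * (cnj u * (cnj z - \<i>) + (cnj z + \<i>)))) / (u * (cnj u * (cnj z - \<i>) - (cnj z + \<i>)))"
    using \<open>u \<noteq> 0\<close> by (simp add: herglotz_kernel_def)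
  also have "\<dots> = (- \<i> * ((u * cnj u) * (cnj z - \<i>) + u * (cnj z + \<i>))) /
      ((u * cnj u) * (cnj z - \<i>) - u * (cnj z + \<i>))"
    by (simp only: ring_distribs mult_ac)
  also have "\<dots> = (- (\<i> * (u * (cnj z + \<i>) + (cnj z - \<i>)))) / (- (u * (cnj z + \<i>) - (cnj z - \<i>)))"
    unfolding u1 by (intro arg_cong2[where f = "(/)"]) (simp_all add: algebra_simps)
  also have "\<dots> = herglotz_kernel (cnj z) u"
    unfolding herglotz_kernel_def minus_divide_divide ..
  finally show ?thesis .
qed

text \<open>Because the kernel is a Moebius transformation in \<open>z\<close>, its difference quotient is explicit, and
  differentiation under the integral needs only dominated convergence of this expression.\<close>

lemma herglotz_kernel_difference_quotient:
  assumes "norm u = 1" "Im z \<noteq> 0" "Im y \<noteq> 0" "y \<noteq> z"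
  shows "(herglotz_kernel y u - herglotz_kernel z u) / (y - z) =
    - 4 * u / ((u * (y + \<i>) - (y - \<i>)) * (u * (z + \<i>) - (z - \<i>)))"
proof -
  let ?D = "\<lambda>x. u * (x + \<i>) - (x - \<i>)" and ?N = "\<lambda>x. u * (x + \<i>) + (x - \<i>)"
  have nz: "?D y \<noteq> 0" "?D z \<noteq> 0"
    using assms herglotz_kernel_denominator_nonzero by blast+
  have "herglotz_kernel y u - herglotz_kernel z u = (\<i> * (?N y * ?D z - ?N z * ?D y)) / (?D y * ?D z)"
    unfolding herglotz_kernel_def diff_frac_eq[OF nz] by (simp add: algebra_simps)
  also have "\<i> * (?N y * ?D z - ?N z * ?D y) = - 4 * u * (y - z)"
    by (simp add: algebra_simps)
  finally show ?thesis using assms(4) by simp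
qed

lemma space_circle_borel: "space circle_borel = sphere 0 1"
  by (simp add: circle_borel_def space_restrict_space)

lemma herglotz_kernel_measurable:
  assumes "Im z \<noteq> 0"
  shows "herglotz_kernel z \<in> borel_measurable circle_borel"
  unfolding circle_borel_def herglotz_kernel_def
  using herglotz_kernel_denominator_nonzero[OF _ assms]
  by (intro borel_measurable_continuous_on_restrict continuous_intros) auto

lemma herglotz_kernel_bound:
  assumes "norm u = 1" "Im z \<noteq> 0"
  shows "norm (herglotz_kernel z u) \<le>
    (norm (z + \<i>) + norm (z - \<i>)) / \<bar>norm (z + \<i>) - norm (z - \<i>)\<bar>"
proof -
  have "norm (u * (z + \<i>) + (z - \<i>)) \<le> norm (z + \<i>) + norm (z - \<i>)"
    using norm_triangle_ineq[of "u * (z + \<i>)" "z - \<i>"] assms(1) by (simp add: norm_mult)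
  then show ?thesis
    unfolding herglotz_kernel_def norm_divide norm_mult
    using herglotz_kernel_denominator_bound[OF assms(1), of z] cmod_plus_i_ne_minus_i[OF assms(2)]
    by (intro frac_le) (auto simp: norm_mult)
qed

lemma integrable_herglotz_kernel:
  assumes P: "finite_measure P" "sets P = sets circle_borel" and z: "Im z \<noteq> 0"
  shows "integrable P (herglotz_kernel z)"
proof (rule finite_measure.integrable_const_bound[OF P(1)])
  have "space P = sphere 0 1"
    using P(2) sets_eq_imp_space_eq space_circle_borel by blast
  then show "AE u in P. norm (herglotz_kernel z u) \<le>
      (norm (z + \<i>) + norm (z - \<i>)) / \<bar>norm (z + \<i>) - norm (z - \<i>)\<bar>"
    using herglotz_kernel_bound z by (intro AE_I2) auto
  show "herglotz_kernel z \<in> borel_measurable P"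
    using herglotz_kernel_measurable[OF z] measurable_cong_sets[OF P(2) refl] by blast
qed

lemma has_field_derivative_integral_herglotz_kernel:
  assumes P: "finite_measure P" "sets P = sets circle_borel" and z: "Im z \<noteq> 0"
  shows "((\<lambda>z. \<integral>u. herglotz_kernel z u \<partial>P) has_field_derivative
    (\<integral>u. - 4 * u / ((u * (z + \<i>) - (z - \<i>)) * (u * (z + \<i>) - (z - \<i>))) \<partial>P)) (at z)"
proof -
  define d where "d y = \<bar>norm (y + \<i>) - norm (y - \<i>)\<bar>" for y :: complex
  have dz: "d z > 0" using cmod_plus_i_ne_minus_i[OF z] by (simp add: d_def)
  have sp: "space P = sphere 0 1"
    using P(2) sets_eq_imp_space_eq space_circle_borel by blast
  \<comment> \<open>A neighbourhood of \<open>z\<close> off the real line with a uniform bound on the denominators.\<close>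
  define S where "S = {y. d y > d z / 2}"
  have "open S"
    unfolding S_def d_def by (intro open_Collect_less continuous_intros)
  moreover have "z \<in> S" using dz by (simp add: S_def)
  ultimately have at_S: "at z within S = at z" by (rule at_within_open[rotated])
  have S_Im: "Im y \<noteq> 0" if "y \<in> S" for y
  proof
    assume "Im y = 0"
    then have "norm (y + \<i>) = norm (y - \<i>)" by (simp add: cmod_def)
    with that dz show False by (simp add: S_def d_def)
  qed
  let ?D = "\<lambda>y u. u * (y + \<i>) - (y - \<i>)"
  have D_bound: "norm (?D y u) \<ge> d z / 2" if "norm u = 1" "y \<in> S" for y u
    using herglotz_kernel_denominator_bound[OF that(1), of y] that(2) by (simp add: S_def d_def)
  have D_nz: "?D y u \<noteq> 0" if "norm u = 1" "y \<in> S" for y u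
    using herglotz_kernel_denominator_nonzero[OF that(1) S_Im[OF that(2)]] .
  have meas: "(\<lambda>u. - 4 * u / (?D y u * ?D z u)) \<in> borel_measurable P" if "y \<in> S" for y
  proof -
    have "continuous_on (sphere 0 1) (\<lambda>u. - 4 * u / (?D y u * ?D z u))"
      using D_nz[OF _ that] D_nz[OF _ \<open>z \<in> S\<close>] by (intro continuous_intros) auto
    then have "(\<lambda>u. - 4 * u / (?D y u * ?D z u)) \<in> borel_measurable circle_borel"
      unfolding circle_borel_def by (rule borel_measurable_continuous_on_restrict)
    then show ?thesis using measurable_cong_sets[OF P(2) refl] by blast
  qed
  have "((\<lambda>y. ((\<integral>u. herglotz_kernel y u \<partial>P) - (\<integral>u. herglotz_kernel z u \<partial>P)) / (y - z)) \<longlongrightarrow>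
      (\<integral>u. - 4 * u / (?D z u * ?D z u) \<partial>P)) (at z within S)"
    unfolding tendsto_at_iff_sequentially o_def
  proof (intro allI impI)
    fix X :: "nat \<Rightarrow> complex"
    assume X: "\<forall>i. X i \<in> S - {z}" and lim: "X \<longlonglongrightarrow> z"
    have eq: "((\<integral>u. herglotz_kernel (X i) u \<partial>P) - (\<integral>u. herglotz_kernel z u \<partial>P)) / (X i - z) =
        (\<integral>u. - 4 * u / (?D (X i) u * ?D z u) \<partial>P)" for i
    proof -
      have Xi: "Im (X i) \<noteq> 0" "X i \<noteq> z" using X S_Im by auto
      have "((\<integral>u. herglotz_kernel (X i) u \<partial>P) - (\<integral>u. herglotz_kernel z u \<partial>P)) / (X i - z) =
          (\<integral>u. (herglotz_kernel (X i) u - herglotz_kernel z u) / (X i - z) \<partial>P)"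
        using integrable_herglotz_kernel[OF P Xi(1)] integrable_herglotz_kernel[OF P z] by simp
      also have "\<dots> = (\<integral>u. - 4 * u / (?D (X i) u * ?D z u) \<partial>P)"
        by (rule Bochner_Integration.integral_cong)
           (use herglotz_kernel_difference_quotient[OF _ z Xi] sp in auto)
      finally show ?thesis .
    qed
    have "(\<lambda>i. \<integral>u. - 4 * u / (?D (X i) u * ?D z u) \<partial>P) \<longlonglongrightarrow> (\<integral>u. - 4 * u / (?D z u * ?D z u) \<partial>P)"
    proof (rule integral_dominated_convergence[where w = "\<lambda>_. 4 / (d z / 2 * (d z / 2))"])
      show "AE u in P. (\<lambda>i. - 4 * u / (?D (X i) u * ?D z u)) \<longlonglongrightarrow> - 4 * u / (?D z u * ?D z u)"
        using D_nz[OF _ \<open>z \<in> S\<close>] sp by (intro AE_I2 tendsto_intros lim) auto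
      show "AE u in P. norm (- 4 * u / (?D (X i) u * ?D z u)) \<le> 4 / (d z / 2 * (d z / 2))" for i
      proof (intro AE_I2)
        fix u assume "u \<in> space P"
        then have u: "norm u = 1" using sp by simp
        have "d z / 2 * (d z / 2) \<le> norm (?D (X i) u) * norm (?D z u)"
          using D_bound[OF u] X \<open>z \<in> S\<close> dz by (intro mult_mono) auto
        then show "norm (- 4 * u / (?D (X i) u * ?D z u)) \<le> 4 / (d z / 2 * (d z / 2))"
          using u dz unfolding norm_divide norm_mult by (intro frac_le) auto
      qed
      show "integrable P (\<lambda>_. 4 / (d z / 2 * (d z / 2)))"
        using finite_measure.integrable_const[OF P(1)] .
    qed (use meas X \<open>z \<in> S\<close> in auto)
    then show "(\<lambda>i. ((\<integral>u. herglotz_kernel (X i) u \<partial>P) - (\<integral>u. herglotz_kernel z u \<partial>P)) / (X i - z)) \<longlonglongrightarrow>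
        (\<integral>u. - 4 * u / (?D z u * ?D z u) \<partial>P)"
      unfolding eq .
  qed
  then show ?thesis
    unfolding has_field_derivative_iff at_S .
qed

lemma herglotz_integral_herglotz_kernel:
  assumes P: "finite_measure P" "sets P = sets circle_borel"
  shows "herglotz (\<lambda>z. of_real a + (\<integral>u. herglotz_kernel z u \<partial>P) / 2)"
  unfolding herglotz_def
proof (intro conjI ballI)
  let ?F = "\<lambda>z. \<integral>u. herglotz_kernel z u \<partial>P"
  have sp: "space P = sphere 0 1"
    using P(2) sets_eq_imp_space_eq space_circle_borel by blast
  have "open (- \<real> :: complex set)" using closed_complex_Reals by blast
  then have "?F holomorphic_on - \<real>"
    unfolding holomorphic_on_open[OF \<open>open (- \<real> :: complex set)\<close>]
    using has_field_derivative_integral_herglotz_kernel[OF P] not_real_iff_Im_nonzero by blast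
  then show "(\<lambda>z. of_real a + ?F z / 2) holomorphic_on - \<real>"
    by (intro holomorphic_intros) auto
  fix z :: complex assume "z \<in> - \<real>"
  then have z: "Im z \<noteq> 0" using not_real_iff_Im_nonzero by blast
  note int = integrable_herglotz_kernel[OF P z]
  have "Im (?F z) / Im z = (\<integral>u. Im (herglotz_kernel z u) / Im z \<partial>P)"
    using int by simp
  also have "\<dots> \<ge> 0"
    using z sp by (intro integral_nonneg_AE AE_I2) (auto simp: Im_herglotz_kernel)
  finally show "Im (of_real a + ?F z / 2) / Im z \<ge> 0" by simp
  have "cnj (?F z) = (\<integral>u. cnj (herglotz_kernel z u) \<partial>P)"
    using int by simp
  also have "\<dots> = ?F (cnj z)"
    by (rule Bochner_Integration.integral_cong) (use sp cnj_herglotz_kernel[OF _ z] in auto)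
  finally show "cnj (of_real a + ?F z / 2) = of_real a + ?F (cnj z) / 2" by simp
qed

lemma complex_integral_cong:
  assumes "\<And>x. x \<in> space M \<Longrightarrow> f x = g x"
  shows "complex_integral M \<nu> f = complex_integral M \<nu> g"
proof -
  have "integral\<^sup>L (upper_variation M \<mu>) f = integral\<^sup>L (upper_variation M \<mu>) g" for \<mu>
    by (rule Bochner_Integration.integral_cong) (use assms in \<open>auto simp: upper_variation_def\<close>)
  then show ?thesis
    by (simp add: complex_integral_def signed_integral_def lower_variation_def)
qed

text \<open>The case \<open>z = -\<i>\<close> is where the convention \<open>(C \<sigma>)(\<infinity>) = 0\<close> is met: there \<open>K = -\<i>\<close> on the
  circle and the integrand \<open>(1 - \<i> K) / 2\<close> vanishes.\<close>

lemma cauchy_transform_inverse_cayley: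
  assumes z: "Im z \<noteq> 0"
  shows "cauchy_transform \<sigma> (inverse_cayley (Some z)) =
    complex_integral circle_borel \<sigma> (\<lambda>u. (1 - \<i> * herglotz_kernel z u) / 2)"
proof (cases "z = - \<i>")
  case True
  have "complex_integral circle_borel \<sigma> (\<lambda>u. (1 - \<i> * herglotz_kernel z u) / 2) =
      complex_integral circle_borel \<sigma> (\<lambda>_. 0)"
    by (rule complex_integral_cong) (simp add: True space_circle_borel herglotz_kernel_minus_i)
  also have "\<dots> = 0" by (simp add: complex_integral_def signed_integral_def)
  finally show ?thesis using True by (simp add: inverse_cayley_def cauchy_transform_def)
next
  case False
  then show ?thesis
    unfolding inverse_cayley_def cauchy_transform_def option.case if_not_P[OF False]
    by (intro complex_integral_cong cauchy_kernel_eq_herglotz_kernel[OF _ z False])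
       (simp add: space_circle_borel)
qed

section \<open>Herglotz representation on the disc\<close>

abbreviation circle_point :: "real \<Rightarrow> complex" where
  "circle_point t \<equiv> exp (2 * of_real pi * \<i> * of_real t)"

lemma norm_circle_point: "norm (circle_point t) = 1"
  using norm_exp_i_times[of "2 * pi * t"] by (simp add: mult_ac)

lemma circle_point_inverse: "circle_point t * cnj (circle_point t) = 1"
  using norm_circle_point[of t] by (simp add: complex_norm_square[symmetric])

lemma Cauchy_integral_circle_point:
  assumes f: "f holomorphic_on cball 0 1" and w: "norm w < 1"
  shows "((\<lambda>t. f (circle_point t) * (circle_point t / (circle_point t - w))) has_integral f w) {0..1}"
proof -
  have C: "((\<lambda>u. f u / (u - w)) has_contour_integral (2 * of_real pi * \<i> * f w)) (circlepath 0 1)"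
    using f w by (intro Cauchy_integral_circlepath_simple) auto
  have "circlepath 0 1 t = circle_point t" for t
    by (simp add: circlepath)
  note circlepath_eq = this
  have "((\<lambda>t. f (circle_point t) / (circle_point t - w) * (2 * of_real pi * \<i> * circle_point t))
      has_integral (2 * of_real pi * \<i> * f w)) {0..1}"
    using C unfolding has_contour_integral_def
    by (rule has_integral_eq[rotated]) (simp add: vector_derivative_circlepath01 circlepath_eq)
  from has_integral_mult_right[OF this, of "1 / (2 * of_real pi * \<i>)"]
  have I: "((\<lambda>t. 1 / (2 * of_real pi * \<i>) * (f (circle_point t) / (circle_point t - w) * (2 * of_real pi * \<i> * circle_point t)))
      has_integral f w) {0..1}" by simp
  have cancel: "1 / p * (x / y * (p * e)) = x * (e / y)" if "p \<noteq> 0" for p x y e :: complex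
    using that by simp
  have "1 / (2 * of_real pi * \<i>) * (x / y * (2 * of_real pi * \<i> * e)) = x * (e / y)" for x y e
    by (rule cancel) simp
  with I show ?thesis by (simp only:)
qed

text \<open>Cauchy's formula integrates \<open>f\<close> against \<open>u / (u - w)\<close> to \<open>f w\<close>. On the circle this kernel is the
  conjugate of \<open>1 / (1 - cnj w * u)\<close>, which is holomorphic in \<open>u\<close>, so by the mean value property
  \<open>cnj f\<close> integrates against it to \<open>cnj (f 0)\<close>. The formula is half the sum of both.\<close>

lemma Schwarz_integral_formula:
  assumes f: "f holomorphic_on cball 0 1" and w: "norm w < 1"
  shows "((\<lambda>t. Re (f (circle_point t)) *\<^sub>R (circle_point t / (circle_point t - w)))
    has_integral (f w + cnj (f 0)) / 2) {0..1}"
proof -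
  have nz: "1 - cnj w * u \<noteq> 0" if "norm u \<le> 1" for u
  proof
    assume "1 - cnj w * u = 0"
    then have "norm w * norm u = 1" by (metis complex_mod_cnj eq_iff_diff_eq_0 norm_mult norm_one)
    moreover have "norm w * norm u \<le> norm w * 1" using that by (intro mult_left_mono) auto
    ultimately show False using w by simp
  qed
  have "(\<lambda>u. f u / (1 - cnj w * u)) holomorphic_on cball 0 1"
    using nz by (intro holomorphic_intros f) auto
  \<comment> \<open>Cauchy's formula at the centre is the mean value property.\<close>
  from Cauchy_integral_circle_point[OF this, of 0]
  have "((\<lambda>t. f (circle_point t) / (1 - cnj w * circle_point t)) has_integral f 0) {0..1}"
    by simp
  then have "((\<lambda>t. cnj (f (circle_point t) / (1 - cnj w * circle_point t))) has_integral cnj (f 0)) {0..1}"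
    using has_integral_cnj[of "\<lambda>t. f (circle_point t) / (1 - cnj w * circle_point t)"] by (simp add: o_def)
  moreover have "cnj (f (circle_point t) / (1 - cnj w * circle_point t)) =
      cnj (f (circle_point t)) * (circle_point t / (circle_point t - w))" for t
  proof -
    let ?e = "circle_point t"
    have "?e - w = ?e * (1 - w * cnj ?e)"
      using circle_point_inverse[of t] by (simp add: algebra_simps)
    then have "?e / (?e - w) = 1 / (1 - w * cnj ?e)" by simp
    then show ?thesis by simp
  qed
  ultimately have "((\<lambda>t. cnj (f (circle_point t)) * (circle_point t / (circle_point t - w)))
      has_integral cnj (f 0)) {0..1}"
    by simp
  from has_integral_add[OF Cauchy_integral_circle_point[OF f w] this]
  have "((\<lambda>t. f (circle_point t) * (circle_point t / (circle_point t - w)) +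
      cnj (f (circle_point t)) * (circle_point t / (circle_point t - w))) has_integral (f w + cnj (f 0))) {0..1}" .
  from has_integral_mult_right[OF this, of "1/2"]
  have "((\<lambda>t. 1/2 * (f (circle_point t) * (circle_point t / (circle_point t - w)) +
      cnj (f (circle_point t)) * (circle_point t / (circle_point t - w)))) has_integral (f w + cnj (f 0)) / 2) {0..1}"
    by simp
  moreover have "1/2 * (x * k + cnj x * k) = Re x *\<^sub>R k" for x k
    using complex_add_cnj[of x] by (simp add: ring_distribs(2)[symmetric] scaleR_conv_of_real)
  ultimately show ?thesis by (simp only:)
qed

lemma circle_point_kernel_continuous:
  assumes "norm w < 1"
  shows "continuous_on A (\<lambda>t. circle_point t / (circle_point t - w))"
  using assms norm_circle_point by (intro continuous_intros) (metis eq_iff_diff_eq_0 less_irrefl)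

lemma circle_point_kernel_bound:
  assumes "norm w < 1"
  shows "norm (circle_point t / (circle_point t - w)) \<le> 1 / (1 - norm w)"
  using assms norm_triangle_ineq2[of "circle_point t" w]
  unfolding norm_divide norm_circle_point by (intro frac_le) auto

text \<open>Normalised to mass one, the densities on the unit interval become distributions on the real
  line, which is the setting of Helly's selection theorem. Their common compact support makes any
  family of them tight.\<close>

lemma normalized_density_unit_interval:
  fixes g :: "real \<Rightarrow> real"
  assumes cont: "continuous_on {0..1} g" and nonneg: "\<And>t. t \<in> {0..1} \<Longrightarrow> 0 \<le> g t"
    and m: "(g has_integral m) {0..1}" "m > 0"
  defines "\<mu> \<equiv> density lborel (\<lambda>t. ennreal (indicator {0..1} t * g t / m))"
  shows "real_distribution \<mu>" and "measure \<mu> {-1<..1} = 1"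
    and "\<And>(k :: real \<Rightarrow> complex) I. continuous_on UNIV k \<Longrightarrow> ((\<lambda>t. g t *\<^sub>R k t) has_integral I) {0..1} \<Longrightarrow>
      integral\<^sup>L \<mu> k = I / of_real m"
proof -
  have ig: "set_integrable lborel {0..1} g" using cont by (rule borel_integrable_atLeastAtMost')
  then have igm: "integrable lborel (\<lambda>t. indicator {0..1} t * g t / m)"
    by (simp add: set_integrable_def)
  have meas[measurable]: "(\<lambda>t. indicator {0..1} t * g t / m) \<in> borel_measurable borel"
    using borel_measurable_integrable[OF igm] by simp
  have nn: "indicator {0..1} t * g t / m \<ge> 0" for t :: real
    using nonneg[of t] m(2) by (auto simp: indicator_def)
  have "(\<integral>t. indicator {0..1} t * g t / m \<partial>lborel) = 1"
    using set_borel_integral_eq_integral(2)[OF ig] m integral_unique[OF m(1)]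
    by (simp add: set_lebesgue_integral_def)
  then have nn1: "(\<integral>\<^sup>+t. ennreal (indicator {0..1} t * g t / m) \<partial>lborel) = 1"
    using nn_integral_eq_integral[OF igm] nn by simp
  have em: "emeasure \<mu> A = 1" if "{0..1} \<subseteq> A" "A \<in> sets borel" for A
  proof -
    have "emeasure \<mu> A = (\<integral>\<^sup>+t. ennreal (indicator {0..1} t * g t / m) * indicator A t \<partial>lborel)"
      unfolding \<mu>_def using that by (subst emeasure_density) auto
    also have "\<dots> = (\<integral>\<^sup>+t. ennreal (indicator {0..1} t * g t / m) \<partial>lborel)"
      using that by (intro nn_integral_cong) (auto simp: indicator_def)
    finally show ?thesis using nn1 by simp
  qed
  have "sets \<mu> = sets borel" "space \<mu> = UNIV" by (simp_all add: \<mu>_def)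
  then show "real_distribution \<mu>"
    using em[of UNIV]
    by (intro real_distribution.intro prob_spaceI real_distribution_axioms.intro) simp_all
  show "measure \<mu> {-1<..1} = 1"
    using em[of "{-1<..1}"] by (simp add: measure_def subset_eq)
  fix k :: "real \<Rightarrow> complex" and I
  assume k: "continuous_on UNIV k" and I: "((\<lambda>t. g t *\<^sub>R k t) has_integral I) {0..1}"
  have [measurable]: "k \<in> borel_measurable borel" using k by (rule borel_measurable_continuous_onI)
  have igk: "set_integrable lborel {0..1} (\<lambda>t. g t *\<^sub>R k t)"
    using cont continuous_on_subset[OF k]
    by (intro borel_integrable_atLeastAtMost' continuous_intros) auto
  have "integral\<^sup>L \<mu> k = (\<integral>t. (indicator {0..1} t * g t / m) *\<^sub>R k t \<partial>lborel)"
    unfolding \<mu>_def using nn by (intro integral_density) auto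
  also have "\<dots> = (\<integral>t. (1 / m) *\<^sub>R (indicator {0..1} t *\<^sub>R (g t *\<^sub>R k t)) \<partial>lborel)"
    by (intro Bochner_Integration.integral_cong) (simp_all add: mult_ac)
  also have "\<dots> = (1 / m) *\<^sub>R (LINT t:{0..1}|lborel. g t *\<^sub>R k t)"
    unfolding set_lebesgue_integral_def by (rule Bochner_Integration.integral_scaleR_right) 
  also have "\<dots> = (1 / m) *\<^sub>R I"
    using set_borel_integral_eq_integral(2)[OF igk] integral_unique[OF I] by simp
  finally show "integral\<^sup>L \<mu> k = I / of_real m" by (simp add: scaleR_conv_of_real)
qed

text \<open>The measures with density \<open>Re f(r u)\<close> have mass \<open>Re f(0)\<close> for all \<open>r < 1\<close>, by the Schwarz formula at
  \<open>w = 0\<close>. A weak limit of them as \<open>r \<rightarrow> 1\<close> represents \<open>f\<close> at every \<open>w\<close>, since the kernel is bounded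
  and continuous on the circle. If \<open>Re f(0) = 0\<close>, then normalising is impossible, but the densities
  have integral \<open>0\<close> and \<open>f\<close> is constant.\<close>

lemma Herglotz_representation_disc:
  assumes f: "f holomorphic_on ball 0 1" and pos: "\<And>w. norm w < 1 \<Longrightarrow> 0 \<le> Re (f w)"
  obtains M where "real_distribution M"
    and "\<And>w. norm w < 1 \<Longrightarrow>
      f w = - cnj (f 0) + 2 * of_real (Re (f 0)) * (\<integral>t. circle_point t / (circle_point t - w) \<partial>M)"
proof -
  define r :: "nat \<Rightarrow> real" where "r n = 1 - 1 / (real n + 2)" for n
  have r: "0 < r n" "r n < 1" for n by (auto simp: r_def field_simps)
  have r_lim: "r \<longlonglongrightarrow> 1" unfolding r_def by real_asymp
  have shrink: "norm (of_real (r n) * w) < 1" if "norm w \<le> 1" for n and w :: complex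
  proof -
    have "norm (of_real (r n) * w) = r n * norm w" using r(1)[of n] by (simp add: norm_mult)
    also have "\<dots> \<le> r n" using that r(1)[of n] by (intro mult_left_le) auto
    also have "\<dots> < 1" by (rule r)
    finally show ?thesis .
  qed
  define g where "g n t = Re (f (of_real (r n) * circle_point t))" for n t
  have holo: "(\<lambda>w. f (of_real (r n) * w)) holomorphic_on cball 0 1" for n
    using holomorphic_on_compose_gen[OF _ f, of "\<lambda>w. of_real (r n) * w" "cball 0 1"] shrink
    by (auto simp: o_def image_subset_iff intro!: holomorphic_intros)
  have g_cont: "continuous_on {0..1} (g n)" for n
    unfolding g_def
    by (intro continuous_intros continuous_on_compose2[OF holomorphic_on_imp_continuous_on[OF holo[of n]]])
       (auto simp: norm_circle_point)
  have g_nonneg: "0 \<le> g n t" for n t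
    unfolding g_def by (intro pos shrink) (simp add: norm_circle_point)
  have schwarz: "((\<lambda>t. g n t *\<^sub>R (circle_point t / (circle_point t - w)))
      has_integral (f (of_real (r n) * w) + cnj (f 0)) / 2) {0..1}" if "norm w < 1" for n w
    using Schwarz_integral_formula[OF holo that, of n] by (simp add: g_def)
  have mass: "(g n has_integral Re (f 0)) {0..1}" for n
  proof -
    have "((\<lambda>t. g n t *\<^sub>R (circle_point t / (circle_point t - 0)))
      has_integral (f 0 + cnj (f 0)) / 2) {0..1}"
      using schwarz[of 0 n] by simp
    then have "((\<lambda>t. of_real (g n t)) has_integral (complex_of_real (Re (f 0)))) {0..1}"
      by (simp add: complex_add_cnj scaleR_conv_of_real)
    from has_integral_Re[OF this] show ?thesis by simp
  qed
  have lim_f: "(\<lambda>n. (f (of_real (r (s n)) * w) + cnj (f 0)) / 2) \<longlonglongrightarrow> (f w + cnj (f 0)) / 2"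
    if "norm w < 1" "strict_mono s" for w s
  proof -
    have "isCont f w"
      using holomorphic_on_imp_continuous_on[OF f] that(1) by (simp add: continuous_on_eq_continuous_at)
    moreover have "(\<lambda>n. of_real (r (s n)) * w) \<longlonglongrightarrow> of_real 1 * w"
      using LIMSEQ_subseq_LIMSEQ[OF r_lim that(2)] by (intro tendsto_intros) (simp add: o_def)
    ultimately have "(\<lambda>n. f (of_real (r (s n)) * w)) \<longlonglongrightarrow> f w"
      by (simp add: isCont_tendsto_compose[of w f])
    then show ?thesis by (intro tendsto_intros) simp_all
  qed
  have "0 \<le> Re (f 0)" using pos by simp
  then consider "Re (f 0) = 0" | "Re (f 0) > 0" by linarith
  then show thesis
  proof cases
    case 1
    have "f w + cnj (f 0) = 0" if w: "norm w < 1" for w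
    proof -
      have zero: "f (of_real (r n) * w) + cnj (f 0) = 0" for n
      proof -
        let ?k = "\<lambda>t. g n t *\<^sub>R (circle_point t / (circle_point t - w))"
        have "norm (integral {0..1} ?k) \<le> integral {0..1} (\<lambda>t. g n t * (1 / (1 - norm w)))"
        proof (rule integral_norm_bound_integral)
          show "?k integrable_on {0..1}" using schwarz[OF w] by blast
          show "(\<lambda>t. g n t * (1 / (1 - norm w))) integrable_on {0..1}"
            using has_integral_mult_left[OF mass[of n]] by blast
          show "norm (?k t) \<le> g n t * (1 / (1 - norm w))" for t
            unfolding norm_scaleR using g_nonneg[of n t] circle_point_kernel_bound[OF w, of t]
            by (simp only: abs_of_nonneg) (rule mult_left_mono)
        qed
        also have "\<dots> = 0" using integral_unique[OF mass[of n]] 1 by simp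
        finally have "integral {0..1} ?k = 0" by simp
        then show ?thesis using integral_unique[OF schwarz[OF w, of n]] by simp
      qed
      have "(\<lambda>n :: nat. 0 :: complex) \<longlonglongrightarrow> (f w + cnj (f 0)) / 2"
        using lim_f[OF w strict_mono_id] by (simp add: zero)
      then show ?thesis using LIMSEQ_unique[OF tendsto_const] by fastforce
    qed
    then have "f w = - cnj (f 0) + 2 * of_real (Re (f 0)) * I" if "norm w < 1" for w I
      unfolding 1 using that by (simp add: eq_neg_iff_add_eq_0)
    moreover have "((\<lambda>_. 1 :: real) has_integral 1) {0..1 :: real}"
      using has_integral_const_real[of "1 :: real" 0 1] by simp
    then have "real_distribution (density lborel (\<lambda>t. ennreal (indicator {0..1} t * 1 / 1)))"
      by (intro normalized_density_unit_interval(1)) auto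
    \<comment> \<open>As \<open>Re (f 0) = 0\<close> is the factor of the integral, any distribution represents \<open>f\<close>.\<close>
    ultimately show thesis by (intro that)
  next
    case 2
    define \<mu> where "\<mu> n = density lborel (\<lambda>t. ennreal (indicator {0..1} t * g n t / Re (f 0)))" for n
    note \<mu> = normalized_density_unit_interval[OF g_cont g_nonneg mass 2, folded \<mu>_def]
    have "tight \<mu>"
      unfolding tight_def
    proof (intro conjI allI impI)
      show "real_distribution (\<mu> n)" for n by (rule \<mu>(1))
      fix \<epsilon> :: real assume "\<epsilon> > 0"
      then show "\<exists>a b. a < b \<and> (\<forall>n. 1 - \<epsilon> < measure (\<mu> n) {a<..b})"
        using \<mu>(2) by (intro exI[of _ "-1"] exI[of _ 1]) simp
    qed
    then obtain s M where s: "strict_mono s" and M: "real_distribution M"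
        and conv: "weak_conv_m (\<mu> \<circ> id \<circ> s) M"
      using tight_imp_convergent_subsubsequence[OF _ strict_mono_id] by blast
    have "f w = - cnj (f 0) + 2 * of_real (Re (f 0)) * (\<integral>t. circle_point t / (circle_point t - w) \<partial>M)"
      if w: "norm w < 1" for w
    proof -
      let ?k = "\<lambda>t. circle_point t / (circle_point t - w)"
      have k: "continuous_on UNIV ?k" by (rule circle_point_kernel_continuous[OF w])
      have "(\<lambda>n. integral\<^sup>L ((\<mu> \<circ> id \<circ> s) n) ?k) \<longlonglongrightarrow> integral\<^sup>L M ?k"
      proof (rule weak_conv_imp_integral_bdd_continuous_conv)
        show "isCont ?k t" for t using k by (simp add: continuous_on_eq_continuous_at)
        show "norm (?k t) \<le> 1 / (1 - norm w)" for t by (rule circle_point_kernel_bound[OF w])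
      qed (use M conv \<mu>(1) in \<open>auto simp: o_def\<close>)
      then have "(\<lambda>n. (f (of_real (r (s n)) * w) + cnj (f 0)) / 2 / of_real (Re (f 0))) \<longlonglongrightarrow> integral\<^sup>L M ?k"
        by (simp add: \<mu>(3)[OF k schwarz[OF w]])
      moreover have "(\<lambda>n. (f (of_real (r (s n)) * w) + cnj (f 0)) / 2 / of_real (Re (f 0)))
          \<longlonglongrightarrow> (f w + cnj (f 0)) / 2 / of_real (Re (f 0))"
        using 2 by (intro tendsto_divide lim_f[OF w s] tendsto_const) auto
      ultimately have "integral\<^sup>L M ?k = (f w + cnj (f 0)) / 2 / of_real (Re (f 0))"
        by (rule LIMSEQ_unique)
      then have "2 * of_real (Re (f 0)) * integral\<^sup>L M ?k = f w + cnj (f 0)"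
        using 2 by simp
      then show ?thesis by simp
    qed
    then show thesis using that[OF M] by blast
  qed
qed

section \<open>Herglotz representation off the real line\<close>

lemma norm_inverse_cayley_less_1:
  assumes "Im z > 0"
  shows "norm ((z - \<i>) / (z + \<i>)) < 1"
proof -
  have "(norm (z - \<i>))\<^sup>2 < (norm (z + \<i>))\<^sup>2"
    using assms unfolding cmod_power2 by (simp add: power2_eq_square algebra_simps)
  then have "norm (z - \<i>) < norm (z + \<i>)" by (rule power2_less_imp_less) simp
  moreover from this have "norm (z + \<i>) > 0" using norm_ge_zero[of "z - \<i>"] by linarith
  ultimately show ?thesis by (simp add: norm_divide)
qed

lemma Im_cayley_pos:
  assumes "norm w < 1"
  shows "Im (\<i> * (1 + w) / (1 - w)) > 0"
proof -
  have "w \<noteq> 1" using assms by auto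
  have "(norm w)\<^sup>2 < 1" using assms by (simp add: power_less_one_iff)
  then have "(Re w)\<^sup>2 + (Im w)\<^sup>2 < 1" by (simp add: cmod_power2)
  then have "0 < (1 + Re w) * (1 - Re w) - Im w * Im w"
    by (simp add: power2_eq_square algebra_simps)
  moreover have "0 < (norm (1 - w))\<^sup>2" using \<open>w \<noteq> 1\<close> by simp
  moreover have "Im (\<i> * (1 + w) / (1 - w)) =
      ((1 + Re w) * (1 - Re w) - Im w * Im w) / (norm (1 - w))\<^sup>2"
    by (simp add: Im_divide cmod_power2)
  ultimately show ?thesis by simp
qed

lemma finite_measure_density_const:
  assumes "finite_measure M"
  shows "finite_measure (density M (\<lambda>_. ennreal c))"
proof (rule finite_measureI)
  have "emeasure (density M (\<lambda>_. ennreal c)) (space M) = ennreal c * emeasure M (space M)"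
    by (rule emeasure_density_const) simp
  also have "\<dots> \<noteq> \<infinity>"
    using finite_measure.emeasure_finite[OF assms] by (simp add: ennreal_mult_eq_top_iff)
  finally show "emeasure (density M (\<lambda>_. ennreal c)) (space (density M (\<lambda>_. ennreal c))) \<noteq> \<infinity>"
    by simp
qed

text \<open>For \<open>Im z > 0\<close> this is the representation on the disc, transported by the Cayley transform and
  rewritten from the Cauchy kernel to \<open>K\<close>. The lower half-plane follows by conjugation, since \<open>h\<close> and
  \<open>K\<close> have the same symmetry and the constant \<open>Re h(\<i>)\<close> is real.\<close>

lemma Herglotz_representation:
  assumes h: "herglotz h"
  obtains P where "finite_measure P" "sets P = sets circle_borel"
    and "\<And>z. Im z \<noteq> 0 \<Longrightarrow> h z = of_real (Re (h \<i>)) + (\<integral>u. herglotz_kernel z u \<partial>P) / 2"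
proof -
  have holo: "h holomorphic_on - \<real>"
    and pos: "\<And>z. Im z \<noteq> 0 \<Longrightarrow> Im (h z) / Im z \<ge> 0"
    and sym: "\<And>z. Im z \<noteq> 0 \<Longrightarrow> cnj (h z) = h (cnj z)"
    using h not_real_iff_Im_nonzero unfolding herglotz_def by blast+
  define f where "f w = - \<i> * h (\<i> * (1 + w) / (1 - w))" for w
  have f: "f holomorphic_on ball 0 1"
  proof -
    have "(\<lambda>w. \<i> * (1 + w) / (1 - w)) holomorphic_on ball 0 1"
      by (intro holomorphic_intros) auto
    moreover have "(\<lambda>w. \<i> * (1 + w) / (1 - w)) ` ball 0 1 \<subseteq> - \<real>"
      using Im_cayley_pos not_real_iff_Im_nonzero by (force simp: image_subset_iff)
    ultimately have "(\<lambda>w. h (\<i> * (1 + w) / (1 - w))) holomorphic_on ball 0 1"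
      using holomorphic_on_compose_gen[OF _ holo] by (simp add: o_def)
    then show ?thesis unfolding f_def by (intro holomorphic_intros)
  qed
  have Re_f: "0 \<le> Re (f w)" if "norm w < 1" for w
    using pos[of "\<i> * (1 + w) / (1 - w)"] Im_cayley_pos[OF that] by (simp add: f_def zero_le_divide_iff)
  obtain M where M: "real_distribution M" and rep: "\<And>w. norm w < 1 \<Longrightarrow>
      f w = - cnj (f 0) + 2 * of_real (Re (f 0)) * (\<integral>t. circle_point t / (circle_point t - w) \<partial>M)"
    using Herglotz_representation_disc[OF f Re_f] by blast
  interpret M: real_distribution M by (rule M)
  define m where "m = Im (h \<i>)"
  have f0: "f 0 = - \<i> * h \<i>" by (simp add: f_def)
  have m: "m \<ge> 0" "Re (f 0) = m" using Re_f[of 0] by (simp_all add: f0 m_def)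
  have circle_meas: "circle_point \<in> measurable M circle_borel"
    unfolding circle_borel_def
  proof (rule measurable_restrict_space2)
    have "circle_point \<in> borel_measurable borel"
      by (intro borel_measurable_continuous_onI continuous_intros)
    then show "circle_point \<in> borel_measurable M"
      by (simp add: measurable_cong_sets[OF M.events_eq_borel refl])
  qed (simp add: norm_circle_point)
  define P0 where "P0 = distr M circle_borel circle_point"
  \<comment> \<open>The factor 2 compensates the \<open>1/2\<close> in front of the integral against \<open>K\<close>.\<close>
  define P where "P = density P0 (\<lambda>_. ennreal (2 * m))"
  have "finite_measure P0"
    unfolding P0_def using circle_meas by (rule M.finite_measure_distr)
  then have finP: "finite_measure P" unfolding P_def by (rule finite_measure_density_const)
  have setsP: "sets P = sets circle_borel" by (simp add: P_def P0_def)
  have intP: "(\<integral>u. herglotz_kernel z u \<partial>P) = 2 * m * (\<integral>t. herglotz_kernel z (circle_point t) \<partial>M)"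
    and intM: "integrable M (\<lambda>t. herglotz_kernel z (circle_point t))" if z: "Im z \<noteq> 0" for z
  proof -
    note meas = herglotz_kernel_measurable[OF z]
    have measP0: "herglotz_kernel z \<in> borel_measurable P0"
      using meas by (simp add: P0_def)
    have "(\<integral>u. herglotz_kernel z u \<partial>P) = (\<integral>u. (2 * m) *\<^sub>R herglotz_kernel z u \<partial>P0)"
      unfolding P_def using m by (intro integral_density measP0) auto
    also have "\<dots> = 2 * m * (\<integral>u. herglotz_kernel z u \<partial>P0)"
      by (subst Bochner_Integration.integral_scaleR_right) (simp add: scaleR_conv_of_real)
    also have "(\<integral>u. herglotz_kernel z u \<partial>P0) = (\<integral>t. herglotz_kernel z (circle_point t) \<partial>M)"
      unfolding P0_def by (rule integral_distr[OF circle_meas meas])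
    finally show "(\<integral>u. herglotz_kernel z u \<partial>P) = 2 * m * (\<integral>t. herglotz_kernel z (circle_point t) \<partial>M)" .
    have "integrable P0 (herglotz_kernel z)"
      by (rule integrable_herglotz_kernel[OF \<open>finite_measure P0\<close> _ z]) (simp add: P0_def)
    then show "integrable M (\<lambda>t. herglotz_kernel z (circle_point t))"
      unfolding P0_def by (rule integrable_distr[OF circle_meas])
  qed
  have upper: "h z = of_real (Re (h \<i>)) + (\<integral>u. herglotz_kernel z u \<partial>P) / 2" if "Im z > 0" for z
  proof -
    have z: "Im z \<noteq> 0" "z + \<i> \<noteq> 0" using that by (auto simp: complex_eq_iff)
    let ?w = "(z - \<i>) / (z + \<i>)"
    have w: "norm ?w < 1" by (rule norm_inverse_cayley_less_1[OF that])
    have "1 + ?w = 2 * z / (z + \<i>)" "1 - ?w = 2 * \<i> / (z + \<i>)"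
      using z(2) by (simp_all add: field_simps)
    then have "\<i> * (1 + ?w) / (1 - ?w) = z" using z(2) by simp
    then have hz: "h z = \<i> * f ?w" by (simp add: f_def)
    have kernel: "circle_point t / (circle_point t - ?w) = (1 - \<i> * herglotz_kernel z (circle_point t)) / 2" for t
    proof -
      let ?e = "circle_point t"
      have "?e - ?w = ?e * (1 - cnj ?e * ?w)"
        using circle_point_inverse[of t] by (simp add: algebra_simps)
      then have "?e / (?e - ?w) = 1 / (1 - cnj ?e * ?w)" by simp
      also have "\<dots> = (1 - \<i> * herglotz_kernel z ?e) / 2"
        using that by (intro cauchy_kernel_eq_herglotz_kernel norm_circle_point z(1)) auto
      finally show ?thesis .
    qed
    have "2 * (\<integral>t. circle_point t / (circle_point t - ?w) \<partial>M) =
        1 - \<i> * (\<integral>t. herglotz_kernel z (circle_point t) \<partial>M)"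
      unfolding kernel using intM[OF z(1)] M.prob_space by (simp add: scaleR_conv_of_real)
    moreover have "f ?w = - cnj (f 0) + m * (2 * (\<integral>t. circle_point t / (circle_point t - ?w) \<partial>M))"
      unfolding rep[OF w] m(2) by (simp only: mult_ac)
    ultimately have "f ?w = - cnj (f 0) + m * (1 - \<i> * (\<integral>t. herglotz_kernel z (circle_point t) \<partial>M))"
      by (simp only:)
    also have "\<dots> = - cnj (f 0) + m - \<i> * ((\<integral>u. herglotz_kernel z u \<partial>P) / 2)"
      unfolding intP[OF z(1)] by (simp add: algebra_simps)
    finally have fw: "f ?w = - cnj (f 0) + m - \<i> * ((\<integral>u. herglotz_kernel z u \<partial>P) / 2)" .
    have "h z = - (\<i> * cnj (f 0)) + \<i> * m + (\<integral>u. herglotz_kernel z u \<partial>P) / 2"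
      unfolding hz fw by (simp add: algebra_simps)
    moreover have "- (\<i> * cnj (f 0)) + \<i> * m = of_real (Re (h \<i>))"
      by (simp add: f0 m_def complex_eq_iff)
    ultimately show ?thesis by simp
  qed
  have spP: "space P = sphere 0 1"
    using setsP sets_eq_imp_space_eq space_circle_borel by blast
  show thesis
  proof (rule that[OF finP setsP])
    fix z assume z: "Im z \<noteq> 0"
    show "h z = of_real (Re (h \<i>)) + (\<integral>u. herglotz_kernel z u \<partial>P) / 2"
    proof (cases "Im z > 0")
      case False
      then have cz: "Im (cnj z) > 0" using z by simp
      have "h z = cnj (h (cnj z))" using sym[of "cnj z"] z by simp
      also have "\<dots> = of_real (Re (h \<i>)) + cnj (\<integral>u. herglotz_kernel (cnj z) u \<partial>P) / 2"
        by (subst upper[OF cz]) simp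
      also have "cnj (\<integral>u. herglotz_kernel (cnj z) u \<partial>P) = (\<integral>u. cnj (herglotz_kernel (cnj z) u) \<partial>P)"
        using integrable_herglotz_kernel[OF finP setsP, of "cnj z"] z by simp
      also have "\<dots> = (\<integral>u. herglotz_kernel z u \<partial>P)"
        using cnj_herglotz_kernel[of _ "cnj z"] z spP
        by (intro Bochner_Integration.integral_cong) auto
      finally show ?thesis .
    qed (rule upper)
  qed
qed

section \<open>Quasi-Herglotz functions as Cauchy transforms\<close>

lemma integral_cauchy_kernel:
  assumes P: "finite_measure P" "sets P = sets circle_borel" and z: "Im z \<noteq> 0"
  shows "(\<integral>u. (1 - \<i> * herglotz_kernel z u) / 2 \<partial>P) =
    of_real (measure P (space P)) / 2 - \<i> * ((\<integral>u. herglotz_kernel z u \<partial>P) / 2)"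
proof -
  have "(\<integral>u. (1 - \<i> * herglotz_kernel z u) / 2 \<partial>P) = (\<integral>u. 1 - \<i> * herglotz_kernel z u \<partial>P) / 2"
    by (rule integral_divide_zero)
  also have "(\<integral>u. 1 - \<i> * herglotz_kernel z u \<partial>P) =
      of_real (measure P (space P)) - \<i> * (\<integral>u. herglotz_kernel z u \<partial>P)"
    using integrable_herglotz_kernel[OF P z] finite_measure.integrable_const[OF P(1)]
    by (subst Bochner_Integration.integral_diff) (auto simp: scaleR_conv_of_real)
  finally show ?thesis by (simp add: diff_divide_distrib)
qed

text \<open>The function \<open>-\<i> \<integral> K z u \<partial>P / 2\<close> coming from a measure \<open>P\<close> is \<open>-\<i>\<close> times a Herglotz function. Hence
  the real part \<open>A - B\<close> of \<open>\<sigma>\<close> contributes to the functions \<open>h\<^sub>3\<close>, \<open>h\<^sub>4\<close> with exchanged signs, and the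
  imaginary part \<open>C - D\<close> to \<open>h\<^sub>1\<close>, \<open>h\<^sub>2\<close>.\<close>

lemma quasi_herglotz_if_cauchy_representation:
  assumes "cauchy_representation q c \<sigma>"
  shows "quasi_herglotz q"
proof -
  have cm: "complex_measure circle_borel \<sigma>"
    and q: "\<And>z. Im z \<noteq> 0 \<Longrightarrow> q z = c + cauchy_transform \<sigma> (inverse_cayley (Some z))"
    using assms not_real_iff_Im_nonzero unfolding cauchy_representation_def by blast+
  obtain A B C D :: "complex measure" where
    fin: "finite_measure A" "finite_measure B" "finite_measure C" "finite_measure D"
    and sets: "sets A = sets circle_borel" "sets B = sets circle_borel"
      "sets C = sets circle_borel" "sets D = sets circle_borel"
    and int: "\<And>f. complex_integral circle_borel \<sigma> f =
      (integral\<^sup>L A f - integral\<^sup>L B f) + \<i> * (integral\<^sup>L C f - integral\<^sup>L D f)"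
    using complex_integral_decomposition[OF cm] by blast
  let ?K = "\<lambda>P z. (\<integral>u. herglotz_kernel z u \<partial>P) / 2"
  define t where "t P = complex_of_real (measure P (space P)) / 2" for P :: "complex measure"
  define k where "k = c + (t A - t B) + \<i> * (t C - t D)"
  note H = herglotz_integral_herglotz_kernel
  show ?thesis
    unfolding quasi_herglotz_def
  proof (intro exI conjI ballI)
    show "herglotz (\<lambda>z. of_real (Re k) + ?K C z)" by (rule H[OF fin(3) sets(3)])
    show "herglotz (\<lambda>z. of_real 0 + ?K D z)" by (rule H[OF fin(4) sets(4)])
    show "herglotz (\<lambda>z. of_real (Im k) + ?K B z)" by (rule H[OF fin(2) sets(2)])
    show "herglotz (\<lambda>z. of_real 0 + ?K A z)" by (rule H[OF fin(1) sets(1)])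
    fix z :: complex assume "z \<in> - \<real>"
    then have z: "Im z \<noteq> 0" using not_real_iff_Im_nonzero by blast
    note C = integral_cauchy_kernel[OF _ _ z, folded t_def]
    have "q z = c + (((t A - \<i> * ?K A z) - (t B - \<i> * ?K B z)) +
        \<i> * ((t C - \<i> * ?K C z) - (t D - \<i> * ?K D z)))"
      using q[OF z] unfolding cauchy_transform_inverse_cayley[OF z] int
        C[OF fin(1) sets(1)] C[OF fin(2) sets(2)] C[OF fin(3) sets(3)] C[OF fin(4) sets(4)] .
    also have "\<dots> = k + (?K C z - ?K D z) + \<i> * (?K B z - ?K A z)"
      by (simp add: k_def algebra_simps)
    also have "\<dots> = (of_real (Re k) + \<i> * of_real (Im k)) + (?K C z - ?K D z) + \<i> * (?K B z - ?K A z)"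
      by (simp add: complex_eq[symmetric])
    finally show "q z = (of_real (Re k) + ?K C z - (of_real 0 + ?K D z)) +
        \<i> * (of_real (Im k) + ?K B z - (of_real 0 + ?K A z))"
      by (simp add: algebra_simps)
  qed
qed

text \<open>Up to constants, \<open>\<integral> K z u \<partial>P / 2\<close> is \<open>\<i>\<close> times the Cauchy transform of \<open>P\<close>. So \<open>\<sigma>\<close> is \<open>\<i>\<close> times
  the combination of the representing measures, which explains the order of the measures in its
  real and imaginary parts.\<close>

lemma cauchy_representation_if_quasi_herglotz:
  assumes "quasi_herglotz q"
  obtains c \<sigma> where "cauchy_representation q c \<sigma>"
proof -
  obtain h1 h2 h3 h4 where herg: "herglotz h1" "herglotz h2" "herglotz h3" "herglotz h4"
    and q: "\<And>z. Im z \<noteq> 0 \<Longrightarrow> q z = (h1 z - h2 z) + \<i> * (h3 z - h4 z)"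
    using assms not_real_iff_Im_nonzero unfolding quasi_herglotz_def by blast
  let ?K = "\<lambda>P z. (\<integral>u. herglotz_kernel z u \<partial>P) / 2"
  obtain P1 where P1: "finite_measure P1" "sets P1 = sets circle_borel"
    "\<And>z. Im z \<noteq> 0 \<Longrightarrow> h1 z = of_real (Re (h1 \<i>)) + ?K P1 z"
    using Herglotz_representation[OF herg(1)] by blast
  obtain P2 where P2: "finite_measure P2" "sets P2 = sets circle_borel"
    "\<And>z. Im z \<noteq> 0 \<Longrightarrow> h2 z = of_real (Re (h2 \<i>)) + ?K P2 z"
    using Herglotz_representation[OF herg(2)] by blast
  obtain P3 where P3: "finite_measure P3" "sets P3 = sets circle_borel"
    "\<And>z. Im z \<noteq> 0 \<Longrightarrow> h3 z = of_real (Re (h3 \<i>)) + ?K P3 z"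
    using Herglotz_representation[OF herg(3)] by blast
  obtain P4 where P4: "finite_measure P4" "sets P4 = sets circle_borel"
    "\<And>z. Im z \<noteq> 0 \<Longrightarrow> h4 z = of_real (Re (h4 \<i>)) + ?K P4 z"
    using Herglotz_representation[OF herg(4)] by blast
  define t where "t P = complex_of_real (measure P (space P)) / 2" for P :: "complex measure"
  define \<sigma> where "\<sigma> X = Complex (measure P4 X - measure P3 X) (measure P1 X - measure P2 X)" for X
  note \<sigma> = complex_integral_of_differences[OF P4(1) P3(1) P1(1) P2(1) P4(2) P3(2) P1(2) P2(2), folded \<sigma>_def]
  define c where "c = of_real (Re (h1 \<i>)) - of_real (Re (h2 \<i>)) + \<i> * (of_real (Re (h3 \<i>)) - of_real (Re (h4 \<i>)))
    - (t P4 - t P3) - \<i> * (t P1 - t P2)"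
  have "cauchy_representation q c \<sigma>"
    unfolding cauchy_representation_def
  proof (intro conjI ballI)
    show "complex_measure circle_borel \<sigma>" by (rule \<sigma>(1))
    fix z :: complex assume "z \<in> - \<real>"
    then have z: "Im z \<noteq> 0" using not_real_iff_Im_nonzero by blast
    let ?B = "(norm (z + \<i>) + norm (z - \<i>)) / \<bar>norm (z + \<i>) - norm (z - \<i>)\<bar>"
    note C = integral_cauchy_kernel[OF _ _ z, folded t_def]
    have "cauchy_transform \<sigma> (inverse_cayley (Some z)) =
        complex_integral circle_borel \<sigma> (\<lambda>u. (1 - \<i> * herglotz_kernel z u) / 2)"
      by (rule cauchy_transform_inverse_cayley[OF z])
    also have "\<dots> = ((t P4 - \<i> * ?K P4 z) - (t P3 - \<i> * ?K P3 z)) +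
        \<i> * ((t P1 - \<i> * ?K P1 z) - (t P2 - \<i> * ?K P2 z))"
    proof (subst \<sigma>(2)[where K = "(1 + ?B) / 2"])
      show "(\<lambda>u. (1 - \<i> * herglotz_kernel z u) / 2) \<in> borel_measurable circle_borel"
        using herglotz_kernel_measurable[OF z] by measurable
      fix u assume "u \<in> space circle_borel"
      then have "norm (herglotz_kernel z u) \<le> ?B"
        using herglotz_kernel_bound[OF _ z] by (simp add: space_circle_borel)
      then have "norm (1 - \<i> * herglotz_kernel z u) \<le> 1 + ?B"
        using norm_triangle_ineq4[of 1 "\<i> * herglotz_kernel z u"] by (simp add: norm_mult)
      then show "norm ((1 - \<i> * herglotz_kernel z u) / 2) \<le> (1 + ?B) / 2"
        by (simp add: norm_divide)
    qed (simp only: C[OF P1(1,2)] C[OF P2(1,2)] C[OF P3(1,2)] C[OF P4(1,2)])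
    finally have "c + cauchy_transform \<sigma> (inverse_cayley (Some z)) =
       (of_real (Re (h1 \<i>)) + ?K P1 z - (of_real (Re (h2 \<i>)) + ?K P2 z)) +
       \<i> * (of_real (Re (h3 \<i>)) + ?K P3 z - (of_real (Re (h4 \<i>)) + ?K P4 z))"
      by (simp add: c_def algebra_simps)
    then show "q z = c + cauchy_transform \<sigma> (inverse_cayley (Some z))"
      unfolding q[OF z] P1(3)[OF z, symmetric] P2(3)[OF z, symmetric] P3(3)[OF z, symmetric] P4(3)[OF z, symmetric] by simp
  qed
  then show thesis by (rule that)
qed

lemma quasi_herglotz_data_at_minus_i:
  assumes "quasi_herglotz_data q a b \<nu>"
  shows "q (- \<i>) = a - \<i> * (b + 1 / of_real pi * complex_integral borel \<nu> (\<lambda>t. 1))"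
proof -
  have kernel: "(1 + of_real t * (- \<i>)) / (of_real t - (- \<i>)) = - \<i> * 1" for t :: real
  proof -
    have "of_real t + \<i> \<noteq> 0" by (simp add: complex_eq_iff)
    then show ?thesis by (simp add: divide_eq_eq algebra_simps)
  qed
  have "complex_integral borel \<nu> (\<lambda>t. - \<i> * 1) = - \<i> * complex_integral borel \<nu> (\<lambda>t. 1)"
    unfolding complex_integral_def signed_integral_def integral_mult_right_zero
    by (simp add: algebra_simps)
  moreover have "- \<i> \<in> - \<real>" by (simp add: not_real_iff_Im_nonzero)
  ultimately have "q (- \<i>) = a + b * (- \<i>) + 1 / of_real pi * (- \<i> * complex_integral borel \<nu> (\<lambda>t. 1))"
    using assms unfolding quasi_herglotz_data_def by (metis (no_types, lifting) kernel ext)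
  then show ?thesis by (simp add: algebra_simps)
qed

theorem theorem8p4:
  fixes q :: "complex \<Rightarrow> complex"
  assumes "q holomorphic_on (- \<real>)"
  shows "(quasi_herglotz q \<longleftrightarrow> (\<exists>c \<sigma>. cauchy_representation q c \<sigma>)) \<and>
    (\<forall>c \<sigma>. cauchy_representation q c \<sigma> \<longrightarrow>
       c = q (- \<i>) \<and>
       (\<forall>a b \<nu>. quasi_herglotz_data q a b \<nu> \<longrightarrow>
          c = a - \<i> * (b + 1 / of_real pi * complex_integral borel \<nu> (\<lambda>t. 1))))"
proof (intro conjI allI impI)
  show "quasi_herglotz q \<longleftrightarrow> (\<exists>c \<sigma>. cauchy_representation q c \<sigma>)"
    using quasi_herglotz_if_cauchy_representation cauchy_representation_if_quasi_herglotz by metis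
  fix c \<sigma> assume rep: "cauchy_representation q c \<sigma>"
  have "- \<i> \<in> - \<real>" using not_real_iff_Im_nonzero[of "- \<i>"] by simp
  then show c: "c = q (- \<i>)"
    using rep by (simp add: cauchy_representation_def inverse_cayley_def cauchy_transform_def)
  fix a b \<nu> assume "quasi_herglotz_data q a b \<nu>"
  then show "c = a - \<i> * (b + 1 / of_real pi * complex_integral borel \<nu> (\<lambda>t. 1))"
    unfolding c by (rule quasi_herglotz_data_at_minus_i)
qed

end
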